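(* Assume that the isometry condition stated in the context is satisfied by the design, with $K\le d$ and constants $\tilde c_n(k)$, $k\le 2K$, and that $\tilde c_n(2K)\sqrt K<1/4$. Let $(\hat\Theta^r)_{r\ge 0}$ be the sequence of estimates produced by the iterative thresholding procedure described in the context with parameters $B>0$, $\delta>0$, $K>0$. Let $r\approx O(\log(n))$ (the number of iterations is of order $\log n$). Then for a constant $C_1>0$ it holds that with probability larger than $1-\delta$ and for any $k\le K/2$: $$\sup_{\Theta\in\mathcal M(k),\ \|\Theta\|_2\le B}\|\Theta-\hat\Theta^r\|_S\le C_1\sqrt{\frac{d\log(1/\delta)}{n}},$$ and also that $$\sup_{\Theta\in\mathcal M(k),\ \|\Theta\|_2\le B}\mathrm{rank}(\hat\Theta^r)\le k,$$ and also that for any $p>0$ $$\sup_{\Theta\in\mathcal M(k),\ \|\Theta\|_2\le B}\|\Theta-\hat\Theta^r\|_{S_p}\le C_1k^{1/p}\sqrt{\frac{d\log(1/\delta)}{n}}.$$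
   Context: Model. $d,n\in\mathbb N$ with $d\le n$ but $d^2\gg n$; $\Theta\in\mathbb R^{d\times d}$ is unknown; for $i\le n$ one observes $Y_i=\mathrm{tr}((X^i)^T\Theta)+\epsilon_i$, where $X^i\in\mathbb R^{d\times d}$ are the design matrices and $\epsilon=(\epsilon_i)_{i\le n}\sim\mathcal N(0,I_n)$ is Gaussian white noise. Notation. $\mathcal M(k)$ is the set of $d\times d$ matrices of rank less than or equal to $k$; $\|A\|_2$ is the Frobenius norm; $\|A\|_S$ is the operator norm (largest singular value); $\|A\|_{S_p}=(\sum_i\lambda_i^p)^{1/p}$, where the $\lambda_i$ are the singular values of $A$, is the Schatten $p$ norm (the same formula is used for all $p>0$). $\mathbb X(A)=(\mathrm{tr}((X^i)^TA))_{i\le n}\in\mathbb R^n$. For a matrix $A$ and $T>0$, $\lfloor A\rfloor_T$ is the entrywise hard thresholded matrix with entries $A_{i,j}\mathbf 1\{|A_{i,j}|\ge T\}$. Isometry condition. $K\le d$, and for any $k\le 2K$, $$\sup_{A\in\mathcal M(k)}\Big|\frac1n\|\mathbb X(A)\|_2^2-\|A\|_2^2\Big|\le\tilde c_n(k)\|A\|_2^2,$$ where $\tilde c_n(k)>0$ (that is, the inequality holds for every $A\in\mathcal M(k)$). Procedure. The parameters are $B>0$ (an upper bound on the Frobenius norm of $\Theta$), $\delta>0$ (a small probability) and $K>0$ (an upper bound on two times the rank of $\Theta$). Set $\hat\Theta^0=0$ and $T_0=B$. For $r\ge1$ the thresholds are $T_r=\rho T_{r-1}+\upsilon_n$, where $\rho=4\tilde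 c_n(2K)\sqrt K$ and $\upsilon_n=C\sqrt{d\log(1/\delta)/n}$, with $C$ a universal constant, namely one for which, with probability larger than $1-\delta$, $\big|\frac1n\langle\mathbb X(A),\epsilon\rangle\big|\le C\|A\|_2\sqrt{d\log(1/\delta)/n}$ for all matrices $A$ of rank at most one. Recursively for $r\ge1$, set $$\hat\Psi^r=\frac1n\sum_{i=1}^nX^i\big(Y_i-\mathrm{tr}((X^i)^T\hat\Theta^{r-1})\big),$$ let $U^r,V^r$ be two orthonormal $d\times d$ matrices that diagonalise $\hat\Theta^{r-1}+\hat\Psi^r$, i.e. such that $(U^r)^T(\hat\Theta^{r-1}+\hat\Psi^r)V^r$ is diagonal, and set $$\hat\Theta^r=U^r\lfloor (U^r)^T(\hat\Theta^{r-1}+\hat\Psi^r)V^r\rfloor_{T_r}(V^r)^T.$$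
   Formalization: In the Schatten bound the constant C_1 is replaced by a constant depending on p, at most 2^{1/p} C_1 (so uniform for p bounded away from 0), since the error can have rank 2k and no single constant works as p tends to 0. *)

theory Defs
  imports
    "HOL-Probability.Probability"
    "Jordan_Normal_Form.Char_Poly"
    "Jordan_Normal_Form.DL_Rank"
begin

definition tr :: "real mat \<Rightarrow> real" where
  "tr A = (\<Sum>i<dim_row A. A $$ (i, i))"

definition frob_norm :: "real mat \<Rightarrow> real" where
  "frob_norm A = sqrt (\<Sum>i<dim_row A. \<Sum>j<dim_col A. (A $$ (i, j))\<^sup>2)"

text \<open>
  Square roots of the eigenvalues of \<open>A\<^sup>T A\<close>, each repeated according to its multiplicity; for a
  \<open>d\<close> by \<open>d\<close> matrix this multiset has exactly \<open>d\<close> elements, since the characteristic polynomial of a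
  real symmetric matrix splits over the reals.
\<close>
definition singular_values :: "real mat \<Rightarrow> real multiset" where
  "singular_values A = image_mset sqrt (proots (char_poly (transpose_mat A * A)))"

definition op_norm :: "real mat \<Rightarrow> real" where
  "op_norm A = Max (set_mset (singular_values A))"

definition schatten_norm :: "real \<Rightarrow> real mat \<Rightarrow> real" where
  "schatten_norm p A = (\<Sum>s\<in>#singular_values A. s powr p) powr (1 / p)"

definition mat_rank :: "nat \<Rightarrow> real mat \<Rightarrow> nat" where
  "mat_rank d A = vec_space.rank d A"

definition low_rank :: "nat \<Rightarrow> nat \<Rightarrow> real mat set" where
  "low_rank d k = {A \<in> carrier_mat d d. mat_rank d A \<le> k}"

definition sampling :: "(nat \<Rightarrow> real mat) \<Rightarrow> real mat \<Rightarrow> nat \<Rightarrow> real" where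
  "sampling X A i = tr (transpose_mat (X i) * A)"

definition isometry_condition ::
    "nat \<Rightarrow> nat \<Rightarrow> (nat \<Rightarrow> real mat) \<Rightarrow> nat \<Rightarrow> (nat \<Rightarrow> real) \<Rightarrow> bool" where
  "isometry_condition d n X K c \<longleftrightarrow>
     K \<le> d \<and>
     (\<forall>k\<le>2 * K. c k > 0 \<and>
       (\<forall>A\<in>low_rank d k.
          \<bar>(\<Sum>i<n. (sampling X A i)\<^sup>2) / n - (frob_norm A)\<^sup>2\<bar> \<le> c k * (frob_norm A)\<^sup>2))"

text \<open>
  The law of \<open>\<epsilon> \<sim> N(0, I\<^sub>n)\<close>; the statement depends on the noise only through this law.
\<close>
definition white_noise :: "nat \<Rightarrow> (nat \<Rightarrow> real) measure" where
  "white_noise n = (\<Pi>\<^sub>M i\<in>{..<n}. density lborel (\<lambda>x. ennreal (std_normal_density x)))"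

text \<open>
  ``With probability larger than \<open>q\<close>, \<open>P\<close> holds'': the event \<open>{x. P x}\<close> itself is not required to be
  measurable, it only has to contain a measurable event of probability larger than \<open>q\<close>.
\<close>
definition with_prob_gt :: "real \<Rightarrow> 'a measure \<Rightarrow> ('a \<Rightarrow> bool) \<Rightarrow> bool" where
  "with_prob_gt q M P \<longleftrightarrow> (\<exists>E\<in>sets M. measure M E > q \<and> (\<forall>x\<in>E. P x))"

definition rate :: "nat \<Rightarrow> nat \<Rightarrow> real \<Rightarrow> real" where
  "rate d n \<delta> = sqrt (d * ln (1 / \<delta>) / n)"

text \<open>
  The event that determines the constant \<open>C\<close> of the procedure: \<open>C\<close> has to be such that this event has
  probability larger than \<open>1 - \<delta>\<close>.
\<close>
definition noise_bound ::
    "real \<Rightarrow> nat \<Rightarrow> nat \<Rightarrow> (nat \<Rightarrow> real mat) \<Rightarrow> real \<Rightarrow> (nat \<Rightarrow> real) \<Rightarrow> bool" where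
  "noise_bound C d n X \<delta> \<epsilon> \<longleftrightarrow>
     (\<forall>A\<in>low_rank d 1.
        \<bar>(\<Sum>i<n. sampling X A i * \<epsilon> i) / n\<bar> \<le> C * frob_norm A * rate d n \<delta>)"

primrec threshold :: "real \<Rightarrow> real \<Rightarrow> real \<Rightarrow> nat \<Rightarrow> real" where
  "threshold B \<rho> \<upsilon> 0 = B"
| "threshold B \<rho> \<upsilon> (Suc r) = \<rho> * threshold B \<rho> \<upsilon> r + \<upsilon>"

definition hard_threshold :: "real \<Rightarrow> real mat \<Rightarrow> real mat" where
  "hard_threshold T A = map_mat (\<lambda>a. if \<bar>a\<bar> \<ge> T then a else 0) A"

definition residual_mat ::
    "nat \<Rightarrow> nat \<Rightarrow> (nat \<Rightarrow> real mat) \<Rightarrow> (nat \<Rightarrow> real) \<Rightarrow> real mat \<Rightarrow> real mat" where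
  "residual_mat d n X Y A =
     mat d d (\<lambda>(a, b). (\<Sum>i<n. X i $$ (a, b) * (Y i - sampling X A i)) / n)"

definition orthonormal_mat :: "nat \<Rightarrow> real mat \<Rightarrow> bool" where
  "orthonormal_mat d U \<longleftrightarrow> U \<in> carrier_mat d d \<and> transpose_mat U * U = 1\<^sub>m d"

text \<open>
  The diagonalising matrices \<open>U\<close>, \<open>V\<close> are not unique, so the procedure is described by the set of
  sequences it can produce, over all admissible choices at every step.
\<close>
definition iht_estimates ::
    "nat \<Rightarrow> nat \<Rightarrow> (nat \<Rightarrow> real mat) \<Rightarrow> (nat \<Rightarrow> real) \<Rightarrow> (nat \<Rightarrow> real) \<Rightarrow> (nat \<Rightarrow> real mat) \<Rightarrow> bool" where
  "iht_estimates d n X Y T E \<longleftrightarrow>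
     E 0 = 0\<^sub>m d d \<and>
     (\<forall>r. \<exists>U V. orthonormal_mat d U \<and> orthonormal_mat d V \<and>
        (let D = transpose_mat U * (E r + residual_mat d n X Y (E r)) * V in
           diagonal_mat D \<and>
           E (Suc r) = U * hard_threshold (T (Suc r)) D * transpose_mat V))"

end

theory Submission
  imports Defs
begin

text \<open>
  The argument is deterministic on the event on which the noise is small against all matrices of
  rank at most one; this event has the required probability by the choice of the constant \<open>C\<close>.

  On this event an induction over the iterations shows that the estimate has rank at most \<open>k\<close> and that
  its operator norm error is at most twice the current threshold \<open>T\<close> (lemma \<open>iht_invariant\<close>). Indeed the
  error then has rank at most \<open>2 k \<le> K\<close>, so its Frobenius norm is at most \<open>2 sqrt(K) T\<close>. The isometry
  condition is a statement about quadratic forms; by polarization it also controls inner products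
  (lemma \<open>isometry_bilinear\<close>), and testing against rank-one matrices \<open>u v\<^sup>T\<close> shows that the gradient
  step produces a matrix whose distance from \<open>\<Theta>\<close> in operator norm is strictly smaller than the next
  threshold (lemma \<open>gradient_step_error\<close>). By Weyl's inequality at most \<open>k\<close> of its singular values reach
  the threshold, so thresholding restores rank at most \<open>k\<close> and adds at most one threshold to the error (lemma
  \<open>hard_threshold_step\<close>).

  The thresholds contract with factor \<open>4 c sqrt(K) \<le> 4 q < 1\<close> towards a multiple of the noise level, and
  after order \<open>ln n\<close> iterations the initial radius \<open>B\<close> is negligible (lemmas \<open>threshold_le_rate\<close> and
  \<open>geometric_decay_below_inverse_sqrt\<close>). The Schatten norm bounds follow because the error has at most
  \<open>2 k\<close> nonzero singular values, which also explains the factor \<open>2 powr (1 / p)\<close>.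

  Singular values are given as square roots of the roots of the characteristic polynomial of the Gram
  matrix. Instead of a full singular value decomposition, the proof uses an orthonormal basis adapted to
  the kernel of a matrix (lemma \<open>adapted_orthonormal_mat\<close>), which bounds the Frobenius norm by the rank
  and the operator norm and counts the nonzero singular values.
\<close>

section \<open>Rank, factorizations and orthonormal bases\<close>

text \<open>
  The matrix is a product of a \<open>d \<times> m\<close> and an \<open>m \<times> d\<close> matrix. Written with functions instead
  of matrices, such factorizations can be added, padded and restricted to index sets without any
  bookkeeping of dimensions.
\<close>

definition factors_through :: "nat \<Rightarrow> nat \<Rightarrow> real mat \<Rightarrow> bool" where
  "factors_through d m M \<longleftrightarrow>
     (\<exists>p r :: nat \<Rightarrow> nat \<Rightarrow> real. \<forall>i<d. \<forall>j<d. M $$ (i, j) = (\<Sum>l<m. p l i * r l j))"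

text \<open>
  The product is a sum of \<open>m\<close> outer products, each of rank at most one, and rank is subadditive.
\<close>

lemma mat_rank_le_if_factors_through:
  assumes M: "M \<in> carrier_mat d d" and f: "factors_through d m M"
  shows "mat_rank d M \<le> m"
proof -
  interpret vec_space "TYPE(real)" d .
  from f obtain p r :: "nat \<Rightarrow> nat \<Rightarrow> real"
    where pr: "\<And>i j. i < d \<Longrightarrow> j < d \<Longrightarrow> M $$ (i, j) = (\<Sum>l<m. p l i * r l j)"
    unfolding factors_through_def by blast
  have partial: "rank (mat d d (\<lambda>(i, j). \<Sum>l<m'. p l i * r l j)) \<le> m'" for m'
  proof (induction m')
    case 0
    have "mat d d (\<lambda>(i, j). \<Sum>l<0. p l i * r l j) = 0\<^sub>m d d"
      by (rule eq_matI) auto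
    then show ?case using rank_0I[of d] by (metis order_refl)
  next
    case (Suc m')
    let ?S = "mat d d (\<lambda>(i, j). \<Sum>l<m'. p l i * r l j)"
    let ?O = "mat d d (\<lambda>(i, j). p m' i * r m' j)"
    have "mat d d (\<lambda>(i, j). \<Sum>l<Suc m'. p l i * r l j) = ?S + ?O"
      by (rule eq_matI) auto
    moreover have "rank (?S + ?O) \<le> rank ?S + rank ?O"
      by (rule rank_subadditive) auto
    moreover have "rank ?O \<le> 1"
      by (rule rank_le_1_product_entries[of _ d "p m'" "r m'"]) auto
    ultimately show ?case using Suc.IH by simp
  qed
  have eq: "M = mat d d (\<lambda>(i, j). \<Sum>l<m. p l i * r l j)"
    using M by (intro eq_matI) (auto simp: pr)
  show ?thesis unfolding mat_rank_def by (subst eq) (rule partial)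
qed

text \<open>
  A maximal linearly independent set of columns has as many elements as the rank, and it spans all
  columns: its members form the left factor, the coefficients of the columns form the right one.
\<close>

lemma factors_through_if_mat_rank_le:
  assumes M: "M \<in> carrier_mat d d" and rk: "mat_rank d M \<le> m"
  shows "factors_through d m M"
proof -
  interpret vec_space "TYPE(real)" d .
  have cs: "set (cols M) \<subseteq> carrier_vec d" using cols_dim M by blast
  have "lin_indpt {}" by (simp add: lin_dep_def)
  then obtain U where "maximal U (\<lambda>T. T \<subseteq> set (cols M) \<and> lin_indpt T)" and finU: "finite U"
    using maximal_exists_superset[of "set (cols M)" "\<lambda>T. T \<subseteq> set (cols M) \<and> lin_indpt T" "{}"]
    by auto
  then have mx: "maximal U (\<lambda>T. T \<subseteq> set (cols M) \<and> lin_indpt T)" by simp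
  have U: "U \<subseteq> set (cols M)" "lin_indpt U" using mx by (auto simp: maximal_def)
  have Uc: "U \<subseteq> carrier_vec d" using U cs by auto
  have cardU: "card U \<le> m"
    using rk rank_card_indpt[OF M mx] unfolding mat_rank_def by simp
  \<comment> \<open>a column outside the span could be added to the maximal independent set\<close>
  have insp: "v \<in> span U" if v: "v \<in> set (cols M)" for v
  proof (rule ccontr)
    assume ns: "v \<notin> span U"
    then have nU: "v \<notin> U" using in_own_span[OF Uc] by auto
    have "lin_indpt (U \<union> {v})"
      using lin_dep_iff_in_span[OF Uc U(2) _ nU] ns v cs by auto
    then have "U \<union> {v} = U" using mx v U unfolding maximal_def by auto
    then show False using nU by auto
  qed
  have "\<exists>a. col M j = lincomb a U" if "j < d" for j
  proof -
    have "col M j \<in> set (cols M)" using that M by (metis carrier_matD(2) cols_length cols_nth nth_mem)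
    then have "col M j \<in> span U" using insp by simp
    from finite_in_span[OF finU Uc this] show ?thesis by metis
  qed
  then obtain a where a: "\<And>j. j < d \<Longrightarrow> col M j = lincomb (a j) U" by metis
  obtain h where h: "bij_betw h {..<card U} U"
    using ex_bij_betw_nat_finite[OF finU] by (auto simp: atLeast0LessThan)
  define p where "p l i = (if l < card U then vec_index (h l) i else 0)" for l i
  define r where "r l j = (if l < card U then a j (h l) else 0)" for l j
  have "M $$ (i, j) = (\<Sum>l<m. p l i * r l j)" if ij: "i < d" "j < d" for i j
  proof -
    have "M $$ (i, j) = vec_index (col M j) i" using ij M by auto
    also have "\<dots> = (\<Sum>u\<in>U. a j u * vec_index u i)"
      using a[OF ij(2)] lincomb_index[OF ij(1) Uc] by simp
    also have "\<dots> = (\<Sum>l<card U. a j (h l) * vec_index (h l) i)"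
      by (rule sum.reindex_bij_betw[OF h, symmetric])
    also have "\<dots> = (\<Sum>l<card U. p l i * r l j)"
      by (rule sum.cong) (simp_all add: p_def r_def)
    also have "\<dots> = (\<Sum>l<m. p l i * r l j)"
      using cardU by (intro sum.mono_neutral_left) (auto simp: p_def)
    finally show ?thesis .
  qed
  then show ?thesis unfolding factors_through_def by blast
qed

lemma factors_through_mono:
  assumes "factors_through d m M" and "m \<le> m'"
  shows "factors_through d m' M"
proof -
  from assms obtain p r :: "nat \<Rightarrow> nat \<Rightarrow> real"
    where pr: "\<And>i j. i < d \<Longrightarrow> j < d \<Longrightarrow> M $$ (i, j) = (\<Sum>l<m. p l i * r l j)"
    unfolding factors_through_def by blast
  have "(\<Sum>l<m. p l i * r l j) = (\<Sum>l<m'. (if l < m then p l i else 0) * r l j)" for i j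
    using assms(2) by (intro sum.mono_neutral_cong_left) auto
  then show ?thesis using pr unfolding factors_through_def
    by (intro exI[of _ "\<lambda>l i. if l < m then p l i else 0"] exI[of _ r]) simp
qed

lemma factors_through_linear_combination:
  assumes "factors_through d m M" and "factors_through d m' N"
    and L: "\<And>i j. i < d \<Longrightarrow> j < d \<Longrightarrow> L $$ (i, j) = s * M $$ (i, j) + t * N $$ (i, j)"
  shows "factors_through d (m + m') L"
proof -
  from assms(1) obtain p r :: "nat \<Rightarrow> nat \<Rightarrow> real"
    where pr: "\<And>i j. i < d \<Longrightarrow> j < d \<Longrightarrow> M $$ (i, j) = (\<Sum>l<m. p l i * r l j)"
    unfolding factors_through_def by blast
  from assms(2) obtain p' r' :: "nat \<Rightarrow> nat \<Rightarrow> real"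
    where pr': "\<And>i j. i < d \<Longrightarrow> j < d \<Longrightarrow> N $$ (i, j) = (\<Sum>l<m'. p' l i * r' l j)"
    unfolding factors_through_def by blast
  define u where "u l i = (if l < m then s * p l i else t * p' (l - m) i)" for l i
  define v where "v l j = (if l < m then r l j else r' (l - m) j)" for l j
  have split: "(\<Sum>l<m + m'. g l) = (\<Sum>l<m. g l) + (\<Sum>l<m'. g (m + l))" for g :: "nat \<Rightarrow> real"
    by (induction m') (auto simp: algebra_simps)
  have "L $$ (i, j) = (\<Sum>l<m + m'. u l i * v l j)" if "i < d" "j < d" for i j
    unfolding L[OF that] pr[OF that] pr'[OF that] split
    by (simp add: u_def v_def sum_distrib_left mult.assoc)
  then show ?thesis unfolding factors_through_def by blast
qed

text \<open>
  Gaussian elimination: an equation with a nonzero coefficient is solved for that unknown, which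
  leaves one equation and one unknown less. Both the orthonormal basis adapted to a kernel and the
  counting of large singular values below rest on this lemma.
\<close>

lemma underdetermined_system:
  fixes a :: "nat \<Rightarrow> 'i \<Rightarrow> real"
  assumes "finite I" and "k < card I"
  shows "\<exists>x. (\<exists>i\<in>I. x i \<noteq> 0) \<and> (\<forall>l<k. (\<Sum>i\<in>I. a l i * x i) = 0)"
  using assms
proof (induction k arbitrary: I a)
  case 0
  then obtain i where "i \<in> I" by fastforce
  then show ?case by (intro exI[of _ "\<lambda>_. 1"]) auto
next
  case (Suc k)
  show ?case
  proof (cases "\<forall>i\<in>I. a k i = 0")
    case True
    from Suc.IH[of I a] Suc.prems obtain x where
      "\<exists>i\<in>I. x i \<noteq> 0" "\<forall>l<k. (\<Sum>i\<in>I. a l i * x i) = 0" by auto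
    then show ?thesis using True by (intro exI[of _ x]) (auto simp: less_Suc_eq)
  next
    case False
    then obtain p where p: "p \<in> I" "a k p \<noteq> 0" by auto
    let ?J = "I - {p}"
    have "finite ?J" "k < card ?J" using Suc.prems p by auto
    from Suc.IH[OF this, of "\<lambda>l i. a l i - a l p * a k i / a k p"] obtain x where
      x: "\<exists>i\<in>?J. x i \<noteq> 0"
        "\<And>l. l < k \<Longrightarrow> (\<Sum>i\<in>?J. (a l i - a l p * a k i / a k p) * x i) = 0" by blast
    define y where "y = x(p := - (\<Sum>i\<in>?J. a k i * x i) / a k p)"
    have S: "(\<Sum>i\<in>I. a l i * y i) = (\<Sum>i\<in>?J. (a l i - a l p * a k i / a k p) * x i)" for l
    proof -
      have "(\<Sum>i\<in>I. a l i * y i) = a l p * y p + (\<Sum>i\<in>?J. a l i * x i)"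
        using Suc.prems p by (subst sum.remove[of I p]) (auto simp: y_def intro!: sum.cong)
      also have "a l p * y p = (\<Sum>i\<in>?J. - (a l p * a k i / a k p) * x i)"
        by (simp add: y_def sum_distrib_left sum_divide_distrib sum_negf mult_ac)
      finally show ?thesis by (simp add: sum.distrib[symmetric] algebra_simps)
    qed
    have "(\<Sum>i\<in>I. a l i * y i) = 0" if "l < Suc k" for l
      using that x(2) p by (auto simp: S less_Suc_eq)
    moreover have "\<exists>i\<in>I. y i \<noteq> 0" using x(1) by (auto simp: y_def)
    ultimately show ?thesis by blast
  qed
qed

text \<open>
  Parseval's identity. The vectors \<open>w a\<close> may be the rows or the columns of an orthonormal matrix.
\<close>

lemma sum_square_orthonormal_combination:
  fixes w :: "nat \<Rightarrow> nat \<Rightarrow> real"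
  assumes "\<And>a b. a < n \<Longrightarrow> b < n \<Longrightarrow> (\<Sum>i<d. w a i * w b i) = (if a = b then 1 else 0)"
  shows "(\<Sum>i<d. (\<Sum>a<n. w a i * x a)\<^sup>2) = (\<Sum>a<n. (x a)\<^sup>2)"
proof -
  have "(\<Sum>i<d. (\<Sum>a<n. w a i * x a)\<^sup>2) = (\<Sum>i<d. \<Sum>a<n. \<Sum>b<n. (w a i * w b i) * (x a * x b))"
    by (simp add: power2_eq_square sum_product mult_ac)
  also have "\<dots> = (\<Sum>a<n. \<Sum>i<d. \<Sum>b<n. (w a i * w b i) * (x a * x b))"
    by (rule sum.swap)
  also have "\<dots> = (\<Sum>a<n. \<Sum>b<n. \<Sum>i<d. (w a i * w b i) * (x a * x b))"
    by (rule sum.cong[OF refl], rule sum.swap)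
  also have "\<dots> = (\<Sum>a<n. \<Sum>b<n. (if a = b then 1 else 0) * (x a * x b))"
    by (intro sum.cong refl) (simp add: sum_distrib_right[symmetric] assms)
  also have "\<dots> = (\<Sum>a<n. (x a)\<^sup>2)"
    by (simp add: if_distrib[of "\<lambda>c. c * _"] power2_eq_square cong: if_cong)
  finally show ?thesis .
qed

lemma orthonormal_mat_columns:
  assumes "orthonormal_mat d U" and "a < d" and "b < d"
  shows "(\<Sum>i<d. U $$ (i, a) * U $$ (i, b)) = (if a = b then 1 else 0)"
proof -
  from assms(1) have U: "U \<in> carrier_mat d d" "transpose_mat U * U = 1\<^sub>m d"
    by (auto simp: orthonormal_mat_def)
  have "(transpose_mat U * U) $$ (a, b) = (\<Sum>i<d. U $$ (i, a) * U $$ (i, b))"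
    using U(1) assms(2,3) by (simp add: scalar_prod_def atLeast0LessThan)
  then show ?thesis using assms(2,3) U(2) by simp
qed

lemma orthonormal_mat_mult_transpose:
  assumes "orthonormal_mat d U"
  shows "U * transpose_mat U = 1\<^sub>m d"
proof -
  from assms have "U \<in> carrier_mat d d" "transpose_mat U * U = 1\<^sub>m d"
    by (auto simp: orthonormal_mat_def)
  then show ?thesis using mat_mult_left_right_inverse[of "transpose_mat U" d U]
    transpose_carrier_mat[of U d d] by blast
qed

lemma orthonormal_mat_rows:
  assumes "orthonormal_mat d U" and "a < d" and "b < d"
  shows "(\<Sum>i<d. U $$ (a, i) * U $$ (b, i)) = (if a = b then 1 else 0)"
proof -
  from assms(1) have U: "U \<in> carrier_mat d d" by (auto simp: orthonormal_mat_def)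
  have "(U * transpose_mat U) $$ (a, b) = (\<Sum>i<d. U $$ (a, i) * U $$ (b, i))"
    using U(1) assms(2,3) by (simp add: scalar_prod_def atLeast0LessThan)
  then show ?thesis using assms(2,3) orthonormal_mat_mult_transpose[OF assms(1)] by simp
qed

text \<open>
  The vectors are picked greedily. Orthogonality to the \<open>s\<close> vectors already chosen costs \<open>s\<close> linear
  equations, and membership in the kernel of \<open>M\<close> costs only \<open>m\<close> more, because it is enough to be
  annihilated by the right factor of \<open>M\<close>. As long as \<open>s < d - m\<close> both demands leave a nonzero
  solution; afterwards only orthogonality is demanded.
\<close>

lemma adapted_orthonormal_list:
  assumes f: "factors_through d m M" and "s \<le> d"
  shows "\<exists>q :: nat \<Rightarrow> nat \<Rightarrow> real.
    (\<forall>a<s. \<forall>b<s. (\<Sum>i<d. q a i * q b i) = (if a = b then 1 else 0)) \<and>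
    (\<forall>a<s. a < d - m \<longrightarrow> (\<forall>i<d. (\<Sum>j<d. M $$ (i, j) * q a j) = 0))"
  using assms(2)
proof (induction s)
  case 0
  then show ?case by simp
next
  case (Suc s)
  from f obtain p r :: "nat \<Rightarrow> nat \<Rightarrow> real"
    where pr: "\<And>i j. i < d \<Longrightarrow> j < d \<Longrightarrow> M $$ (i, j) = (\<Sum>l<m. p l i * r l j)"
    unfolding factors_through_def by blast
  from Suc obtain q :: "nat \<Rightarrow> nat \<Rightarrow> real" where
    q: "\<And>a b. a < s \<Longrightarrow> b < s \<Longrightarrow> (\<Sum>i<d. q a i * q b i) = (if a = b then 1 else 0)"
    and qM: "\<And>a i. a < s \<Longrightarrow> a < d - m \<Longrightarrow> i < d \<Longrightarrow> (\<Sum>j<d. M $$ (i, j) * q a j) = 0"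
    by (metis Suc_leD)
  have "\<exists>x. (\<exists>i<d. x i \<noteq> 0) \<and> (\<forall>a<s. (\<Sum>i<d. q a i * x i) = 0) \<and>
      (s < d - m \<longrightarrow> (\<forall>l<m. (\<Sum>i<d. r l i * x i) = 0))"
  proof (cases "s < d - m")
    case True
    then have "s + m < card {..<d}" by simp
    from underdetermined_system[OF _ this, of "\<lambda>l. if l < s then q l else r (l - s)"]
    obtain x where x: "\<exists>i\<in>{..<d}. x i \<noteq> 0"
      "\<forall>l<s + m. (\<Sum>i<d. (if l < s then q l else r (l - s)) i * x i) = 0" by auto
    have "(\<Sum>i<d. q a i * x i) = 0" if "a < s" for a using x(2)[rule_format, of a] that by simp
    moreover have "(\<Sum>i<d. r l i * x i) = 0" if "l < m" for l
      using x(2)[rule_format, of "s + l"] that by simp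
    ultimately show ?thesis using x(1) by (intro exI[of _ x]) auto
  next
    case False
    have "s < card {..<d}" using Suc.prems by simp
    from underdetermined_system[OF _ this, of q] False show ?thesis by auto
  qed
  then obtain x where x0: "\<exists>i<d. x i \<noteq> 0" and xq: "\<And>a. a < s \<Longrightarrow> (\<Sum>i<d. q a i * x i) = 0"
    and xr: "\<And>l. s < d - m \<Longrightarrow> l < m \<Longrightarrow> (\<Sum>i<d. r l i * x i) = 0" by blast
  define N where "N = (\<Sum>i<d. (x i)\<^sup>2)"
  have N: "N > 0"
  proof -
    from x0 obtain i where "i < d" "x i \<noteq> 0" by auto
    then show ?thesis unfolding N_def by (intro sum_pos2[of _ i]) auto
  qed
  define y where "y i = x i / sqrt N" for i
  have yy: "(\<Sum>i<d. y i * y i) = 1"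
    using N by (simp add: y_def N_def sum_divide_distrib[symmetric] power2_eq_square)
  have yq: "(\<Sum>i<d. q a i * y i) = 0" if "a < s" for a
    using xq[OF that] by (simp add: y_def sum_divide_distrib[symmetric])
  have yr: "(\<Sum>i<d. r l i * y i) = 0" if "s < d - m" "l < m" for l
    using xr[OF that] by (simp add: y_def sum_divide_distrib[symmetric])
  have yM: "(\<Sum>j<d. M $$ (i, j) * y j) = 0" if "s < d - m" "i < d" for i
  proof -
    have "(\<Sum>j<d. M $$ (i, j) * y j) = (\<Sum>j<d. \<Sum>l<m. p l i * (r l j * y j))"
      using that by (simp add: pr sum_distrib_right mult.assoc)
    also have "\<dots> = (\<Sum>l<m. \<Sum>j<d. p l i * (r l j * y j))" by (rule sum.swap)
    also have "\<dots> = 0" using that by (simp add: sum_distrib_left[symmetric] yr)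
    finally show ?thesis .
  qed
  let ?q = "q(s := y)"
  have "(\<Sum>i<d. ?q a i * ?q b i) = (if a = b then 1 else 0)" if "a < Suc s" "b < Suc s" for a b
    using that q yq yy by (auto simp: less_Suc_eq mult.commute)
  moreover have "(\<Sum>j<d. M $$ (i, j) * ?q a j) = 0" if "a < Suc s" "a < d - m" "i < d" for a i
    using that qM yM by (auto simp: less_Suc_eq)
  ultimately show ?case by (intro exI[of _ ?q]) auto
qed

text \<open>
  A substitute for the singular value decomposition: in a suitable orthonormal basis a matrix of
  rank at most \<open>m\<close> lives on the first \<open>m\<close> basis vectors. The greedy list starts with the kernel, so
  it is used in reverse order.
\<close>

lemma adapted_orthonormal_mat:
  assumes M: "M \<in> carrier_mat d d" and f: "factors_through d m M"
  shows "\<exists>Q. orthonormal_mat d Q \<and> (\<forall>i<d. \<forall>j<d. m \<le> j \<longrightarrow> (\<Sum>l<d. M $$ (i, l) * Q $$ (l, j)) = 0)"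
proof -
  from adapted_orthonormal_list[OF f order_refl] obtain q :: "nat \<Rightarrow> nat \<Rightarrow> real" where
    q: "\<And>a b. a < d \<Longrightarrow> b < d \<Longrightarrow> (\<Sum>i<d. q a i * q b i) = (if a = b then 1 else 0)"
    and qM: "\<And>a i. a < d \<Longrightarrow> a < d - m \<Longrightarrow> i < d \<Longrightarrow> (\<Sum>j<d. M $$ (i, j) * q a j) = 0"
    by metis
  define Q where "Q = mat d d (\<lambda>(l, j). q (d - 1 - j) l)"
  have "orthonormal_mat d Q"
    unfolding orthonormal_mat_def
    by (auto intro!: eq_matI simp: Q_def scalar_prod_def atLeast0LessThan q)
  moreover have "(\<Sum>l<d. M $$ (i, l) * Q $$ (l, j)) = 0" if "i < d" "j < d" "m \<le> j" for i j
    using that qM[of "d - 1 - j" i] by (simp add: Q_def)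
  ultimately show ?thesis by blast
qed

section \<open>Operator norm, Frobenius norm and Schatten norms\<close>

text \<open>
  The operator norm is at most \<open>t\<close>, expressed through the bilinear form. This form is additive in the
  matrix and is exactly what testing against the rank-one matrices \<open>u v\<^sup>T\<close> provides.
\<close>

definition spectral_bound :: "nat \<Rightarrow> real \<Rightarrow> real mat \<Rightarrow> bool" where
  "spectral_bound d t M \<longleftrightarrow>
     (\<forall>u v. \<bar>\<Sum>i<d. \<Sum>j<d. u i * M $$ (i, j) * v j\<bar> \<le> t * L2_set u {..<d} * L2_set v {..<d})"

lemma spectral_bound_image:
  assumes "spectral_bound d t M" and "0 \<le> t"
  shows "(\<Sum>i<d. (\<Sum>j<d. M $$ (i, j) * v j)\<^sup>2) \<le> t\<^sup>2 * (\<Sum>j<d. (v j)\<^sup>2)"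
proof -
  \<comment> \<open>test the bilinear form with the image vector itself\<close>
  define u where "u i = (\<Sum>j<d. M $$ (i, j) * v j)" for i
  have "(\<Sum>i<d. \<Sum>j<d. u i * M $$ (i, j) * v j) = (\<Sum>i<d. (u i)\<^sup>2)"
    by (simp add: u_def power2_eq_square sum_distrib_left mult.assoc)
  also have "\<dots> = (L2_set u {..<d})\<^sup>2" by (simp add: L2_set_def sum_nonneg)
  finally have eq: "(\<Sum>i<d. \<Sum>j<d. u i * M $$ (i, j) * v j) = (L2_set u {..<d})\<^sup>2" .
  have "\<bar>\<Sum>i<d. \<Sum>j<d. u i * M $$ (i, j) * v j\<bar> \<le> t * L2_set u {..<d} * L2_set v {..<d}"
    using assms(1) unfolding spectral_bound_def by blast
  then have "(L2_set u {..<d})\<^sup>2 \<le> t * L2_set u {..<d} * L2_set v {..<d}" unfolding eq by simp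
  then have "L2_set u {..<d} * L2_set u {..<d} \<le> L2_set u {..<d} * (t * L2_set v {..<d})"
    by (simp add: power2_eq_square mult_ac)
  then have "L2_set u {..<d} \<le> t * L2_set v {..<d}"
    using assms(2) by (cases "L2_set u {..<d} = 0") (auto simp: mult_le_cancel_left order.strict_iff_order)
  then have "(L2_set u {..<d})\<^sup>2 \<le> (t * L2_set v {..<d})\<^sup>2" by (rule power_mono) simp
  then show ?thesis by (simp add: u_def power_mult_distrib L2_set_def sum_nonneg)
qed

lemma frob_norm_square:
  assumes "M \<in> carrier_mat d d"
  shows "(frob_norm M)\<^sup>2 = (\<Sum>i<d. \<Sum>j<d. (M $$ (i, j))\<^sup>2)"
proof -
  have "dim_row M = d" "dim_col M = d" using assms by auto
  then show ?thesis unfolding frob_norm_def by (simp only: real_sqrt_pow2 sum_nonneg zero_le_power2)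
qed

text \<open>
  The Frobenius norm does not change under multiplication by an orthonormal matrix. In the basis
  adapted to \<open>M\<close> at most \<open>m\<close> columns survive, and each has length at most \<open>t\<close>.
\<close>

lemma frob_norm_le_of_factors_through:
  assumes M: "M \<in> carrier_mat d d" and f: "factors_through d m M"
    and t: "spectral_bound d t M" "0 \<le> t"
  shows "frob_norm M \<le> sqrt m * t"
proof -
  from adapted_orthonormal_mat[OF M f] obtain Q where Q: "orthonormal_mat d Q"
    and Q0: "\<And>i j. i < d \<Longrightarrow> j < d \<Longrightarrow> m \<le> j \<Longrightarrow> (\<Sum>l<d. M $$ (i, l) * Q $$ (l, j)) = 0"
    by blast
  have col: "(\<Sum>i<d. (\<Sum>l<d. M $$ (i, l) * Q $$ (l, j))\<^sup>2) \<le> (if j < m then t\<^sup>2 else 0)" if j: "j < d" for j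
  proof (cases "j < m")
    case True
    have "(\<Sum>l<d. (Q $$ (l, j))\<^sup>2) = 1"
      using orthonormal_mat_columns[OF Q j j] by (simp add: power2_eq_square)
    then show ?thesis using spectral_bound_image[OF t, of "\<lambda>l. Q $$ (l, j)"] True by simp
  next
    case False
    then show ?thesis using Q0 j by simp
  qed
  have "(frob_norm M)\<^sup>2 = (\<Sum>i<d. \<Sum>l<d. (M $$ (i, l))\<^sup>2)" by (rule frob_norm_square[OF M])
  also have "\<dots> = (\<Sum>i<d. \<Sum>j<d. (\<Sum>l<d. M $$ (i, l) * Q $$ (l, j))\<^sup>2)"
  proof (rule sum.cong[OF refl])
    fix i
    show "(\<Sum>l<d. (M $$ (i, l))\<^sup>2) = (\<Sum>j<d. (\<Sum>l<d. M $$ (i, l) * Q $$ (l, j))\<^sup>2)"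
      using sum_square_orthonormal_combination[where w = "\<lambda>a b. Q $$ (a, b)" and x = "\<lambda>l. M $$ (i, l)" and n = d and d = d]
        orthonormal_mat_rows[OF Q] by (simp add: mult.commute)
  qed
  also have "\<dots> = (\<Sum>j<d. \<Sum>i<d. (\<Sum>l<d. M $$ (i, l) * Q $$ (l, j))\<^sup>2)" by (rule sum.swap)
  also have "\<dots> \<le> (\<Sum>j<d. if j < m then t\<^sup>2 else 0)" by (rule sum_mono) (use col in simp)
  also have "\<dots> = real (card ({..<d} \<inter> {j. j < m})) * t\<^sup>2" by (simp add: sum.If_cases)
  also have "\<dots> \<le> real m * t\<^sup>2"
  proof -
    have "card ({..<d} \<inter> {j. j < m}) \<le> card {..<m}" by (intro card_mono) auto
    then show ?thesis by (intro mult_right_mono) auto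
  qed
  also have "\<dots> = (sqrt m * t)\<^sup>2" by (simp add: power_mult_distrib)
  finally show ?thesis using t(2) by - (rule power2_le_imp_le, assumption, simp)
qed

lemma gram_mat_vec_index:
  fixes M :: "'a :: comm_ring_1 mat"
  assumes M: "M \<in> carrier_mat d d" and v: "v \<in> carrier_vec d" and j: "j < d"
  shows "vec_index ((transpose_mat M * M) *\<^sub>v v) j =
    (\<Sum>i<d. M $$ (i, j) * (\<Sum>l<d. M $$ (i, l) * vec_index v l))"
proof -
  have "(transpose_mat M * M) *\<^sub>v v = transpose_mat M *\<^sub>v (M *\<^sub>v v)"
    using M v by (intro assoc_mult_mat_vec) auto
  then show ?thesis using M v j by (simp add: scalar_prod_def atLeast0LessThan)
qed

text \<open>
  For an eigenvector \<open>v\<close> of \<open>M\<^sup>T M\<close>, the number \<open>\<mu> |v|\<^sup>2 = |M v|\<^sup>2\<close> lies between \<open>0\<close> and \<open>t\<^sup>2 |v|\<^sup>2\<close>.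
\<close>

lemma gram_eigenvalue_bounds:
  assumes M: "M \<in> carrier_mat d d" and ev: "eigenvalue (transpose_mat M * M) \<mu>"
    and t: "spectral_bound d t M" "0 \<le> t"
  shows "0 \<le> \<mu> \<and> \<mu> \<le> t\<^sup>2"
proof -
  from ev M obtain v where v: "v \<in> carrier_vec d" "v \<noteq> 0\<^sub>v d"
    "(transpose_mat M * M) *\<^sub>v v = \<mu> \<cdot>\<^sub>v v"
    unfolding eigenvalue_def eigenvector_def by auto
  define x where "x j = vec_index v j" for j
  have eq: "(\<Sum>i<d. M $$ (i, j) * (\<Sum>l<d. M $$ (i, l) * x l)) = \<mu> * x j" if "j < d" for j
    using gram_mat_vec_index[OF M v(1) that] v that by (simp add: x_def)
  obtain j where "j < d" "x j \<noteq> 0"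
    using v(1,2) unfolding x_def by (metis carrier_vecD eq_vecI index_zero_vec(1) index_zero_vec(2))
  then have pos: "(\<Sum>j<d. (x j)\<^sup>2) > 0" by (intro sum_pos2[of _ j]) auto
  have "\<mu> * (\<Sum>j<d. (x j)\<^sup>2) = (\<Sum>j<d. x j * (\<mu> * x j))"
    by (simp add: sum_distrib_left power2_eq_square mult_ac)
  also have "\<dots> = (\<Sum>j<d. x j * (\<Sum>i<d. M $$ (i, j) * (\<Sum>l<d. M $$ (i, l) * x l)))"
    by (simp add: eq)
  also have "\<dots> = (\<Sum>j<d. \<Sum>i<d. M $$ (i, j) * x j * (\<Sum>l<d. M $$ (i, l) * x l))"
    by (simp add: sum_distrib_left[of "x _"] mult_ac)
  also have "\<dots> = (\<Sum>i<d. \<Sum>j<d. M $$ (i, j) * x j * (\<Sum>l<d. M $$ (i, l) * x l))"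
    by (rule sum.swap)
  also have "\<dots> = (\<Sum>i<d. (\<Sum>l<d. M $$ (i, l) * x l)\<^sup>2)"
    by (simp add: sum_distrib_right[symmetric] power2_eq_square)
  finally have eq2: "\<mu> * (\<Sum>j<d. (x j)\<^sup>2) = (\<Sum>i<d. (\<Sum>l<d. M $$ (i, l) * x l)\<^sup>2)" .
  have "0 \<le> \<mu> * (\<Sum>j<d. (x j)\<^sup>2)" unfolding eq2 by (simp add: sum_nonneg)
  moreover have "\<mu> * (\<Sum>j<d. (x j)\<^sup>2) \<le> t\<^sup>2 * (\<Sum>j<d. (x j)\<^sup>2)"
    unfolding eq2 by (rule spectral_bound_image[OF t])
  ultimately show ?thesis using pos by (simp add: zero_le_mult_iff)
qed

lemma singular_values_bounds:
  assumes M: "M \<in> carrier_mat d d" and t: "spectral_bound d t M" "0 \<le> t"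
    and \<mu>: "\<mu> \<in># proots (char_poly (transpose_mat M * M))"
  shows "0 \<le> sqrt \<mu> \<and> sqrt \<mu> \<le> t"
proof -
  have G: "transpose_mat M * M \<in> carrier_mat d d" using M by auto
  have "char_poly (transpose_mat M * M) \<noteq> 0" using \<mu> by auto
  then have "poly (char_poly (transpose_mat M * M)) \<mu> = 0" using \<mu> by auto
  then have "eigenvalue (transpose_mat M * M) \<mu>" using eigenvalue_root_char_poly[OF G] by simp
  then have "0 \<le> \<mu> \<and> \<mu> \<le> t\<^sup>2" by (rule gram_eigenvalue_bounds[OF M _ t])
  then show ?thesis using t(2) real_le_lsqrt by auto
qed

text \<open>
  Over the complex numbers an eigenvalue \<open>z\<close> exists, and for a complex eigenvector \<open>y\<close> the identity
  \<open>z |y|\<^sup>2 = |M y|\<^sup>2\<close> shows that \<open>z\<close> is real. This guarantees that the maximum in the operator norm is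
  taken over a nonempty set.
\<close>

lemma gram_has_real_eigenvalue:
  fixes M :: "real mat"
  assumes M: "M \<in> carrier_mat d d" and d: "0 < d"
  shows "\<exists>x. poly (char_poly (transpose_mat M * M)) x = 0"
proof -
  define Mc where "Mc = map_mat complex_of_real M"
  have Mc: "Mc \<in> carrier_mat d d" using M by (simp add: Mc_def)
  have Mcij: "Mc $$ (i, j) = complex_of_real (M $$ (i, j))" if "i < d" "j < d" for i j
    using M that by (simp add: Mc_def)
  define G where "G = transpose_mat Mc * Mc"
  have G: "G \<in> carrier_mat d d" using Mc by (simp add: G_def)
  have GM: "G = map_mat complex_of_real (transpose_mat M * M)"
    using M by (intro eq_matI) (auto simp: G_def Mc_def scalar_prod_def)
  have "\<not> constant (poly (char_poly G))"
    using degree_monic_char_poly[OF G] d by (simp add: constant_degree)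
  then obtain z where z: "poly (char_poly G) z = 0" using fundamental_theorem_of_algebra by blast
  then have "eigenvalue G z" using eigenvalue_root_char_poly[OF G] by simp
  then obtain v where v: "v \<in> carrier_vec d" "v \<noteq> 0\<^sub>v d" "G *\<^sub>v v = z \<cdot>\<^sub>v v"
    using G unfolding eigenvalue_def eigenvector_def by auto
  define y where "y j = vec_index v j" for j
  define w where "w i = (\<Sum>l<d. Mc $$ (i, l) * y l)" for i
  have eq: "(\<Sum>i<d. Mc $$ (i, j) * w i) = z * y j" if "j < d" for j
    using gram_mat_vec_index[OF Mc v(1) that] v that by (simp add: y_def w_def G_def)
  define S where "S = (\<Sum>j<d. (cmod (y j))\<^sup>2)"
  define W where "W = (\<Sum>i<d. (cmod (w i))\<^sup>2)"
  obtain j where "j < d" "y j \<noteq> 0"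
    using v(1,2) unfolding y_def by (metis carrier_vecD eq_vecI index_zero_vec(1) index_zero_vec(2))
  then have S: "S > 0" unfolding S_def by (intro sum_pos2[of _ j]) auto
  have "z * of_real S = (\<Sum>j<d. cnj (y j) * (z * y j))"
    by (simp add: S_def sum_distrib_left complex_norm_square mult_ac del: of_real_power)
  also have "\<dots> = (\<Sum>j<d. cnj (y j) * (\<Sum>i<d. Mc $$ (i, j) * w i))" by (simp add: eq)
  also have "\<dots> = (\<Sum>j<d. \<Sum>i<d. Mc $$ (i, j) * cnj (y j) * w i)"
    by (simp add: sum_distrib_left mult_ac)
  also have "\<dots> = (\<Sum>i<d. \<Sum>j<d. Mc $$ (i, j) * cnj (y j) * w i)" by (rule sum.swap)
  also have "\<dots> = (\<Sum>i<d. cnj (w i) * w i)"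
    by (intro sum.cong refl) (simp add: w_def Mcij sum_distrib_right)
  also have "\<dots> = of_real W"
    by (simp add: W_def complex_norm_square mult.commute del: of_real_power)
  finally have zWS: "z * of_real S = of_real W" .
  define x where "x = W / S"
  have "z = complex_of_real x" using zWS S by (simp add: x_def field_simps)
  moreover have "char_poly G = map_poly of_real (char_poly (transpose_mat M * M))"
    unfolding GM by (rule of_real_hom.char_poly_hom) (use M in auto)
  ultimately have "complex_of_real (poly (char_poly (transpose_mat M * M)) x) = 0"
    using z by simp
  then show ?thesis by auto
qed

lemma op_norm_le:
  assumes M: "M \<in> carrier_mat d d" and d: "0 < d" and t: "spectral_bound d t M" "0 \<le> t"
  shows "op_norm M \<le> t"
proof -
  have G: "transpose_mat M * M \<in> carrier_mat d d" using M by auto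
  have nz: "char_poly (transpose_mat M * M) \<noteq> 0"
    using degree_monic_char_poly[OF G] by auto
  obtain x where "poly (char_poly (transpose_mat M * M)) x = 0"
    using gram_has_real_eigenvalue[OF M d] by blast
  then have "set_mset (singular_values M) \<noteq> {}" using nz by (auto simp: singular_values_def)
  moreover have "s \<le> t" if "s \<in># singular_values M" for s
    using that singular_values_bounds[OF M t] by (auto simp: singular_values_def simp del: set_count_proots)
  ultimately show ?thesis unfolding op_norm_def by (subst Max_le_iff) auto
qed

text \<open>
  Every summand of the Leibniz formula contains one factor from each of the \<open>d - m\<close> rows in question.
\<close>

lemma power_dvd_det_of_divisible_rows:
  fixes A :: "'a :: comm_ring_1 mat"
  assumes A: "A \<in> carrier_mat d d"
    and div: "\<And>i j. m \<le> i \<Longrightarrow> i < d \<Longrightarrow> j < d \<Longrightarrow> x dvd A $$ (i, j)"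
  shows "x ^ (d - m) dvd det A"
  unfolding det_def'[OF A]
proof (rule dvd_sum)
  fix p assume "p \<in> {p. p permutes {0..<d}}"
  then have p: "p i < d" if "i < d" for i using that permutes_in_image[of p "{0..<d}" i] by auto
  have "x ^ (d - m) = (\<Prod>i\<in>{m..<d}. x)" by simp
  also have "\<dots> dvd (\<Prod>i\<in>{m..<d}. A $$ (i, p i))"
    by (rule prod_dvd_prod) (use div p in auto)
  also have "\<dots> dvd (\<Prod>i = 0..<d. A $$ (i, p i))"
    by (rule prod_dvd_prod_subset) auto
  finally show "x ^ (d - m) dvd signof p * (\<Prod>i = 0..<d. A $$ (i, p i))" by (rule dvd_mult)
qed

text \<open>
  In the basis adapted to \<open>M\<close>, the rows of the Gram matrix from index \<open>m\<close> on vanish. Hence the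
  characteristic polynomial is divisible by \<open>X\<^bsup>d - m\<^esup>\<close>, which leaves room for at most \<open>m\<close>
  nonzero roots, counted with multiplicity.
\<close>

lemma nonzero_gram_eigenvalues_le:
  assumes M: "M \<in> carrier_mat d d" and f: "factors_through d m M"
  shows "size (filter_mset (\<lambda>x. x \<noteq> 0) (proots (char_poly (transpose_mat M * M)))) \<le> m"
proof -
  from adapted_orthonormal_mat[OF M f] obtain Q where Q: "orthonormal_mat d Q"
    and Q0: "\<And>i j. i < d \<Longrightarrow> j < d \<Longrightarrow> m \<le> j \<Longrightarrow> (\<Sum>l<d. M $$ (i, l) * Q $$ (l, j)) = 0"
    by blast
  from Q have Qc: "Q \<in> carrier_mat d d" "transpose_mat Q * Q = 1\<^sub>m d" by (auto simp: orthonormal_mat_def)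
  let ?G = "transpose_mat M * M"
  define P where "P = char_poly ?G"
  have G: "?G \<in> carrier_mat d d" using M by auto
  define H where "H = transpose_mat Q * ?G * Q"
  have H: "H \<in> carrier_mat d d" using Qc M by (auto simp: H_def)
  have H2: "H = transpose_mat (M * Q) * (M * Q)"
  proof -
    have "transpose_mat (M * Q) * (M * Q) = (transpose_mat Q * transpose_mat M) * (M * Q)"
      using M Qc by (simp add: transpose_mult)
    also have "\<dots> = ((transpose_mat Q * transpose_mat M) * M) * Q"
      by (rule assoc_mult_mat[symmetric, of _ d d _ d _ d]) (use M Qc in auto)
    also have "\<dots> = H" unfolding H_def
      by (subst assoc_mult_mat[of _ d d _ d _ d]) (use M Qc in auto)
    finally show ?thesis by simp
  qed
  define N where "N = M * Q"
  have N: "N \<in> carrier_mat d d" using M Qc by (auto simp: N_def)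
  have N0: "N $$ (k, i) = 0" if "k < d" "i < d" "m \<le> i" for k i
    using Q0[OF that] M Qc that by (simp add: N_def scalar_prod_def atLeast0LessThan)
  have H0: "H $$ (i, j) = 0" if "m \<le> i" "i < d" "j < d" for i j
    unfolding H2 N_def[symmetric] using N N0 that by (simp add: scalar_prod_def)
  have "similar_mat_wit H ?G (transpose_mat Q) Q"
    unfolding similar_mat_wit_def Let_def
    using Qc H G orthonormal_mat_mult_transpose[OF Q] by (auto simp: H_def)
  then have PH: "P = char_poly H" unfolding P_def using char_poly_similar similar_mat_def by metis
  \<comment> \<open>in a zero row, the characteristic matrix has only the diagonal entry \<open>X\<close>\<close>
  have "[:0, 1:] ^ (d - m) dvd P"
    unfolding PH char_poly_def
  proof (rule power_dvd_det_of_divisible_rows)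
    show "char_poly_matrix H \<in> carrier_mat d d" using H by simp
    fix i j assume ij: "m \<le> i" "i < d" "j < d"
    show "[:0, 1:] dvd char_poly_matrix H $$ (i, j)"
      using ij H H0[OF ij] by (auto simp: char_poly_matrix_def one_pCons)
  qed
  moreover have deg: "degree P = d" and nz: "P \<noteq> 0"
    using degree_monic_char_poly[OF G] by (auto simp: P_def)
  ultimately have "d - m \<le> Polynomial.order 0 P" using order_divides[of 0 "d - m" P] by simp
  then have "d - m \<le> count (proots P) 0" using nz by simp
  moreover have "size (proots P) \<le> d" using size_proots_le[of P] deg by simp
  moreover have "size (proots P) = size (filter_mset (\<lambda>x. x \<noteq> 0) (proots P)) + count (proots P) 0"
  proof -
    have "size (proots P) =
        size (filter_mset (\<lambda>x. x \<noteq> 0) (proots P) + filter_mset (\<lambda>x. \<not> x \<noteq> 0) (proots P))"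
      by (rule arg_cong[OF multiset_partition])
    also have "\<dots> = size (filter_mset (\<lambda>x. x \<noteq> 0) (proots P)) + size (filter_mset (\<lambda>x. x = 0) (proots P))"
      by (simp only: size_union not_not)
    also have "size (filter_mset (\<lambda>x. x = 0) (proots P)) = count (proots P) 0"
      by (simp add: filter_eq_replicate_mset del: count_proots)
    finally show ?thesis .
  qed
  ultimately show ?thesis unfolding P_def by linarith
qed

text \<open>
  At most \<open>m\<close> singular values are nonzero, and each of them is at most \<open>t\<close>.
\<close>

lemma schatten_norm_le:
  assumes M: "M \<in> carrier_mat d d" and f: "factors_through d m M" and t: "spectral_bound d t M" "0 \<le> t"
    and p: "0 < p"
  shows "schatten_norm p M \<le> real m powr (1 / p) * t"
proof -
  define R where "R = proots (char_poly (transpose_mat M * M))"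
  have "(\<Sum>s\<in>#singular_values M. s powr p) = (\<Sum>x\<in>#R. sqrt x powr p)"
    by (simp add: singular_values_def R_def image_mset.compositionality comp_def)
  also have "\<dots> = (\<Sum>x\<in>#filter_mset (\<lambda>x. x \<noteq> 0) R. sqrt x powr p)
      + (\<Sum>x\<in>#filter_mset (\<lambda>x. \<not> x \<noteq> 0) R. sqrt x powr p)"
    by (subst multiset_partition[of R "\<lambda>x. x \<noteq> 0"]) (simp only: image_mset_union sum_mset.union)
  also have "(\<Sum>x\<in>#filter_mset (\<lambda>x. \<not> x \<noteq> 0) R. sqrt x powr p) = 0"
    by (simp add: filter_eq_replicate_mset)
  also have "(\<Sum>x\<in>#filter_mset (\<lambda>x. x \<noteq> 0) R. sqrt x powr p)
      \<le> (\<Sum>x\<in>#filter_mset (\<lambda>x. x \<noteq> 0) R. t powr p)"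
  proof (rule sum_mset_mono)
    fix x assume "x \<in># filter_mset (\<lambda>x. x \<noteq> 0) R"
    then have "x \<in># R" by simp
    then have "0 \<le> sqrt x \<and> sqrt x \<le> t" unfolding R_def by (rule singular_values_bounds[OF M t])
    then show "sqrt x powr p \<le> t powr p" using p by (intro powr_mono2) auto
  qed
  also have "\<dots> = size (filter_mset (\<lambda>x. x \<noteq> 0) R) * t powr p" by simp
  also have "\<dots> \<le> m * t powr p"
    using nonzero_gram_eigenvalues_le[OF M f] by (intro mult_right_mono) (auto simp: R_def)
  finally have le: "(\<Sum>s\<in>#singular_values M. s powr p) \<le> m * t powr p" by simp
  have "0 \<le> (\<Sum>s\<in>#A. s powr p)" for A :: "real multiset"
    by (induction A) auto
  then have "schatten_norm p M \<le> (m * t powr p) powr (1 / p)"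
    unfolding schatten_norm_def using le p by (intro powr_mono2) auto
  also have "\<dots> = real m powr (1 / p) * t"
    using p t(2) by (simp add: powr_mult powr_powr)
  finally show ?thesis .
qed

lemma spectral_bound_mono:
  assumes "spectral_bound d s M" and "s \<le> t"
  shows "spectral_bound d t M"
  unfolding spectral_bound_def
proof (intro allI)
  fix u v :: "nat \<Rightarrow> real"
  have "\<bar>\<Sum>i<d. \<Sum>j<d. u i * M $$ (i, j) * v j\<bar> \<le> s * (L2_set u {..<d} * L2_set v {..<d})"
    using assms(1) unfolding spectral_bound_def by (simp add: mult.assoc)
  also have "\<dots> \<le> t * (L2_set u {..<d} * L2_set v {..<d})"
    using assms(2) by (intro mult_right_mono) simp_all
  finally show "\<bar>\<Sum>i<d. \<Sum>j<d. u i * M $$ (i, j) * v j\<bar> \<le> t * L2_set u {..<d} * L2_set v {..<d}"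
    by (simp add: mult.assoc)
qed

lemma spectral_bound_diff:
  assumes "spectral_bound d s M" and "spectral_bound d t N"
    and L: "\<And>i j. i < d \<Longrightarrow> j < d \<Longrightarrow> L $$ (i, j) = M $$ (i, j) - N $$ (i, j)"
  shows "spectral_bound d (s + t) L"
  unfolding spectral_bound_def
proof (intro allI)
  fix u v :: "nat \<Rightarrow> real"
  have "(\<Sum>i<d. \<Sum>j<d. u i * L $$ (i, j) * v j) =
      (\<Sum>i<d. \<Sum>j<d. u i * M $$ (i, j) * v j) - (\<Sum>i<d. \<Sum>j<d. u i * N $$ (i, j) * v j)"
    by (simp add: L sum_subtractf[symmetric] algebra_simps)
  moreover have "\<bar>\<Sum>i<d. \<Sum>j<d. u i * M $$ (i, j) * v j\<bar> \<le> s * L2_set u {..<d} * L2_set v {..<d}"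
    using assms(1) unfolding spectral_bound_def by blast
  moreover have "\<bar>\<Sum>i<d. \<Sum>j<d. u i * N $$ (i, j) * v j\<bar> \<le> t * L2_set u {..<d} * L2_set v {..<d}"
    using assms(2) unfolding spectral_bound_def by blast
  ultimately show "\<bar>\<Sum>i<d. \<Sum>j<d. u i * L $$ (i, j) * v j\<bar> \<le> (s + t) * L2_set u {..<d} * L2_set v {..<d}"
    by (simp add: algebra_simps)
qed

lemma L2_set_tensor:
  "sqrt (\<Sum>i<d. \<Sum>j<d. (u i * v j)\<^sup>2) = L2_set u {..<d} * L2_set v {..<d}"
  for u v :: "nat \<Rightarrow> real"
  by (simp add: L2_set_def sum_product power_mult_distrib real_sqrt_mult[symmetric])

lemma frob_norm_nonneg: "0 \<le> frob_norm M"
  unfolding frob_norm_def by (intro real_sqrt_ge_zero sum_nonneg zero_le_power2)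

text \<open>
  Cauchy--Schwarz for the matrices \<open>u v\<^sup>T\<close> and \<open>M\<close>, regarded as vectors with \<open>d\<^sup>2\<close> entries.
\<close>

lemma spectral_bound_frob_norm:
  assumes M: "M \<in> carrier_mat d d"
  shows "spectral_bound d (frob_norm M) M"
  unfolding spectral_bound_def
proof (intro allI)
  fix u v :: "nat \<Rightarrow> real"
  let ?I = "{..<d} \<times> {..<d}"
  let ?f = "\<lambda>(i, j). u i * v j" and ?g = "\<lambda>(i, j). M $$ (i, j)"
  have "(\<Sum>i<d. \<Sum>j<d. u i * M $$ (i, j) * v j) = (\<Sum>x\<in>?I. ?f x * ?g x)"
    by (simp add: sum.cartesian_product split_def mult_ac)
  then have "\<bar>\<Sum>i<d. \<Sum>j<d. u i * M $$ (i, j) * v j\<bar> \<le> (\<Sum>x\<in>?I. \<bar>?f x * ?g x\<bar>)"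
    by (simp only: sum_abs)
  also have "\<dots> = (\<Sum>x\<in>?I. \<bar>?f x\<bar> * \<bar>?g x\<bar>)" by (simp only: abs_mult)
  also have "\<dots> \<le> L2_set ?f ?I * L2_set ?g ?I" by (rule L2_set_mult_ineq)
  also have "L2_set ?f ?I = L2_set u {..<d} * L2_set v {..<d}"
    unfolding L2_set_tensor[symmetric] unfolding L2_set_def
    by (simp add: sum.cartesian_product split_def)
  also have "L2_set ?g ?I = frob_norm M"
    using M unfolding frob_norm_def L2_set_def by (simp add: sum.cartesian_product split_def)
  finally show "\<bar>\<Sum>i<d. \<Sum>j<d. u i * M $$ (i, j) * v j\<bar> \<le> frob_norm M * L2_set u {..<d} * L2_set v {..<d}"
    by (simp add: mult_ac)
qed

section \<open>Hard thresholding of singular values\<close>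

text \<open>
  \<open>A = U diag(s) V\<^sup>T\<close>, read entrywise. The \<open>s l\<close> carry signs: a diagonalisation in the sense of the
  procedure fixes the singular values only up to sign and order.
\<close>

definition svd_entries :: "nat \<Rightarrow> real mat \<Rightarrow> (nat \<Rightarrow> real) \<Rightarrow> real mat \<Rightarrow> real mat \<Rightarrow> bool" where
  "svd_entries d U s V A \<longleftrightarrow>
     (\<forall>i<d. \<forall>j<d. A $$ (i, j) = (\<Sum>l<d. s l * (U $$ (i, l) * V $$ (j, l))))"

lemma svd_entries_diagonal:
  assumes "U \<in> carrier_mat d d" "V \<in> carrier_mat d d" "D \<in> carrier_mat d d" "diagonal_mat D"
  shows "svd_entries d U (\<lambda>l. D $$ (l, l)) V (U * D * transpose_mat V)"
  unfolding svd_entries_def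
proof (intro allI impI)
  fix i j assume ij: "i < d" "j < d"
  have UD: "(U * D) $$ (i, l) = U $$ (i, l) * D $$ (l, l)" if "l < d" for l
  proof -
    have "(U * D) $$ (i, l) = (\<Sum>k<d. U $$ (i, k) * D $$ (k, l))"
      using assms ij that by (simp add: scalar_prod_def atLeast0LessThan)
    also have "\<dots> = (\<Sum>k<d. if k = l then U $$ (i, l) * D $$ (l, l) else 0)"
      using assms that by (intro sum.cong refl) (auto simp: diagonal_mat_def)
    finally show ?thesis using that by simp
  qed
  define W where "W = U * D"
  have W: "W \<in> carrier_mat d d" using assms by (auto simp: W_def)
  have "(U * D * transpose_mat V) $$ (i, j) = (\<Sum>l<d. (U * D) $$ (i, l) * V $$ (j, l))"
    unfolding W_def[symmetric] using assms(2) W ij by (simp add: scalar_prod_def atLeast0LessThan)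
  then show "(U * D * transpose_mat V) $$ (i, j) = (\<Sum>l<d. D $$ (l, l) * (U $$ (i, l) * V $$ (j, l)))"
    by (simp add: UD mult_ac)
qed

lemma orthonormal_conjugation_inverse:
  assumes U: "orthonormal_mat d U" and V: "orthonormal_mat d V" and A: "A \<in> carrier_mat d d"
  shows "U * (transpose_mat U * A * V) * transpose_mat V = A"
proof -
  from U V have c: "U \<in> carrier_mat d d" "V \<in> carrier_mat d d" by (auto simp: orthonormal_mat_def)
  have "U * (transpose_mat U * A * V) = U * (transpose_mat U * (A * V))"
    by (subst assoc_mult_mat[of _ d d _ d _ d]) (use c A in auto)
  also have "\<dots> = (U * transpose_mat U) * (A * V)"
    by (rule assoc_mult_mat[symmetric, of _ d d _ d _ d]) (use c A in auto)
  also have "\<dots> = A * V" using orthonormal_mat_mult_transpose[OF U] c A by simp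
  finally have "U * (transpose_mat U * A * V) * transpose_mat V = A * V * transpose_mat V" by simp
  also have "\<dots> = A * (V * transpose_mat V)"
    by (rule assoc_mult_mat[of _ d d _ d _ d]) (use c A in auto)
  also have "\<dots> = A" using orthonormal_mat_mult_transpose[OF V] A by simp
  finally show ?thesis .
qed

lemma svd_entries_bilinear:
  assumes "svd_entries d U s V A"
  shows "(\<Sum>i<d. \<Sum>j<d. x i * A $$ (i, j) * y j) =
    (\<Sum>l<d. s l * (\<Sum>i<d. U $$ (i, l) * x i) * (\<Sum>j<d. V $$ (j, l) * y j))"
proof -
  have "(\<Sum>i<d. \<Sum>j<d. x i * A $$ (i, j) * y j) =
      (\<Sum>i<d. \<Sum>j<d. \<Sum>l<d. s l * (U $$ (i, l) * x i) * (V $$ (j, l) * y j))"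
    using assms unfolding svd_entries_def
    by (intro sum.cong refl) (simp add: sum_distrib_left sum_distrib_right mult_ac)
  also have "\<dots> = (\<Sum>i<d. \<Sum>l<d. \<Sum>j<d. s l * (U $$ (i, l) * x i) * (V $$ (j, l) * y j))"
    by (rule sum.cong[OF refl], rule sum.swap)
  also have "\<dots> = (\<Sum>l<d. \<Sum>i<d. \<Sum>j<d. s l * (U $$ (i, l) * x i) * (V $$ (j, l) * y j))"
    by (rule sum.swap)
  also have "\<dots> = (\<Sum>l<d. s l * (\<Sum>i<d. U $$ (i, l) * x i) * (\<Sum>j<d. V $$ (j, l) * y j))"
    by (simp add: sum_distrib_left[symmetric] sum_distrib_right[symmetric])
  finally show ?thesis .
qed

lemma L2_set_orthonormal_transpose:
  assumes "orthonormal_mat d U"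
  shows "L2_set (\<lambda>l. \<Sum>i<d. U $$ (i, l) * x i) {..<d} = L2_set x {..<d}"
  using sum_square_orthonormal_combination[where w = "\<lambda>a b. U $$ (a, b)" and x = x and n = d and d = d]
    orthonormal_mat_rows[OF assms] by (simp add: L2_set_def)

lemma L2_set_orthonormal:
  assumes "orthonormal_mat d U"
  shows "L2_set (\<lambda>i. \<Sum>l<d. U $$ (i, l) * x l) {..<d} = L2_set x {..<d}"
  using sum_square_orthonormal_combination[where w = "\<lambda>a b. U $$ (b, a)" and x = x and n = d and d = d]
    orthonormal_mat_columns[OF assms] by (simp add: L2_set_def)

lemma orthonormal_coefficients:
  assumes "orthonormal_mat d U" and "l < d"
  shows "(\<Sum>i<d. U $$ (i, l) * (\<Sum>k<d. U $$ (i, k) * x k)) = x l"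
proof -
  have "(\<Sum>i<d. U $$ (i, l) * (\<Sum>k<d. U $$ (i, k) * x k)) =
      (\<Sum>i<d. \<Sum>k<d. (U $$ (i, l) * U $$ (i, k)) * x k)"
    by (simp add: sum_distrib_left mult.assoc)
  also have "\<dots> = (\<Sum>k<d. \<Sum>i<d. (U $$ (i, l) * U $$ (i, k)) * x k)" by (rule sum.swap)
  also have "\<dots> = (\<Sum>k<d. (if l = k then 1 else 0) * x k)"
    by (intro sum.cong refl)
      (simp only: sum_distrib_right[symmetric] orthonormal_mat_columns[OF assms] lessThan_iff)
  also have "\<dots> = x l" using assms(2) by (simp add: if_distrib[of "\<lambda>c. c * _"] cong: if_cong)
  finally show ?thesis .
qed

lemma spectral_bound_svd_entries:
  assumes U: "orthonormal_mat d U" and V: "orthonormal_mat d V" and A: "svd_entries d U s V A"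
    and s: "\<And>l. l < d \<Longrightarrow> \<bar>s l\<bar> \<le> t" and t: "0 \<le> t"
  shows "spectral_bound d t A"
  unfolding spectral_bound_def
proof (intro allI)
  fix x y :: "nat \<Rightarrow> real"
  define a where "a l = (\<Sum>i<d. U $$ (i, l) * x i)" for l
  define b where "b l = (\<Sum>j<d. V $$ (j, l) * y j)" for l
  have "\<bar>\<Sum>i<d. \<Sum>j<d. x i * A $$ (i, j) * y j\<bar> = \<bar>\<Sum>l<d. s l * a l * b l\<bar>"
    unfolding svd_entries_bilinear[OF A] a_def b_def ..
  also have "\<dots> \<le> (\<Sum>l<d. \<bar>s l * a l * b l\<bar>)" by (rule sum_abs)
  also have "\<dots> \<le> (\<Sum>l<d. t * (\<bar>a l\<bar> * \<bar>b l\<bar>))"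
    by (rule sum_mono) (simp add: abs_mult mult.assoc s mult_right_mono)
  also have "\<dots> = t * (\<Sum>l<d. \<bar>a l\<bar> * \<bar>b l\<bar>)" by (simp add: sum_distrib_left)
  also have "\<dots> \<le> t * (L2_set a {..<d} * L2_set b {..<d})"
    by (intro mult_left_mono L2_set_mult_ineq t)
  also have "\<dots> = t * L2_set x {..<d} * L2_set y {..<d}"
    unfolding a_def b_def by (simp add: L2_set_orthonormal_transpose[OF U] L2_set_orthonormal_transpose[OF V])
  finally show "\<bar>\<Sum>i<d. \<Sum>j<d. x i * A $$ (i, j) * y j\<bar> \<le> t * L2_set x {..<d} * L2_set y {..<d}" .
qed

text \<open>
  Weyl's inequality in the form that is needed. More than \<open>k\<close> large \<open>s l\<close> would give a subspace of
  dimension greater than \<open>k\<close>, spanned by columns of \<open>V\<close>, on which \<open>A\<close> stretches lengths by at least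
  \<open>T\<close>. A matrix of rank at most \<open>k\<close> kills some nonzero \<open>y\<close> in this subspace, where the difference
  \<open>R\<close> coincides with \<open>A\<close> and so stretches by at least \<open>T > \<sigma>\<close>.
\<close>

lemma card_large_singular_values_le:
  assumes U: "orthonormal_mat d U" and V: "orthonormal_mat d V" and A: "svd_entries d U s V A"
    and f: "factors_through d k \<Theta>" and b: "spectral_bound d \<sigma> R"
    and R: "\<And>i j. i < d \<Longrightarrow> j < d \<Longrightarrow> R $$ (i, j) = A $$ (i, j) - \<Theta> $$ (i, j)"
    and T: "\<sigma> < T" "0 < T"
  shows "card {l. l < d \<and> T \<le> \<bar>s l\<bar>} \<le> k"
proof (rule ccontr)
  define I where "I = {l. l < d \<and> T \<le> \<bar>s l\<bar>}"
  assume "\<not> card {l. l < d \<and> T \<le> \<bar>s l\<bar>} \<le> k"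
  then have k: "k < card I" by (simp add: I_def)
  have I: "finite I" "I \<subseteq> {..<d}" by (auto simp: I_def)
  from f obtain p r :: "nat \<Rightarrow> nat \<Rightarrow> real"
    where pr: "\<And>i j. i < d \<Longrightarrow> j < d \<Longrightarrow> \<Theta> $$ (i, j) = (\<Sum>a<k. p a i * r a j)"
    unfolding factors_through_def by blast
  from underdetermined_system[OF I(1) k, of "\<lambda>a l. \<Sum>j<d. r a j * V $$ (j, l)"]
  obtain z0 where z0: "\<exists>l\<in>I. z0 l \<noteq> 0"
    "\<And>a. a < k \<Longrightarrow> (\<Sum>l\<in>I. (\<Sum>j<d. r a j * V $$ (j, l)) * z0 l) = 0" by blast
  \<comment> \<open>\<open>y\<close> lies in the span of the columns of \<open>V\<close> with large \<open>s l\<close>, and \<open>u = A y\<close>\<close>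
  define z where "z l = (if l \<in> I then z0 l else 0)" for l
  define y where "y j = (\<Sum>l<d. V $$ (j, l) * z l)" for j
  define u where "u i = (\<Sum>l<d. U $$ (i, l) * (s l * z l))" for i
  have ry: "(\<Sum>j<d. r a j * y j) = 0" if "a < k" for a
  proof -
    have "(\<Sum>j<d. r a j * y j) = (\<Sum>j<d. \<Sum>l<d. r a j * V $$ (j, l) * z l)"
      by (simp add: y_def sum_distrib_left mult.assoc)
    also have "\<dots> = (\<Sum>l<d. \<Sum>j<d. r a j * V $$ (j, l) * z l)" by (rule sum.swap)
    also have "\<dots> = (\<Sum>l<d. (\<Sum>j<d. r a j * V $$ (j, l)) * z l)" by (simp add: sum_distrib_right)
    also have "\<dots> = (\<Sum>l\<in>I. (\<Sum>j<d. r a j * V $$ (j, l)) * z0 l)"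
      using I by (intro sum.mono_neutral_cong_right) (auto simp: z_def)
    finally show ?thesis using z0(2)[OF that] by simp
  qed
  have \<Theta>y: "(\<Sum>j<d. \<Theta> $$ (i, j) * y j) = 0" if "i < d" for i
  proof -
    have "(\<Sum>j<d. \<Theta> $$ (i, j) * y j) = (\<Sum>j<d. \<Sum>a<k. p a i * (r a j * y j))"
      using that by (simp add: pr sum_distrib_right mult.assoc)
    also have "\<dots> = (\<Sum>a<k. \<Sum>j<d. p a i * (r a j * y j))" by (rule sum.swap)
    also have "\<dots> = 0" by (simp add: sum_distrib_left[symmetric] ry)
    finally show ?thesis .
  qed
  define P where "P = L2_set u {..<d}"
  define Z where "Z = L2_set y {..<d}"
  have P2: "P\<^sup>2 = (\<Sum>l<d. (s l * z l)\<^sup>2)"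
    unfolding P_def u_def L2_set_orthonormal[OF U] by (simp add: L2_set_def sum_nonneg)
  have Z2: "Z\<^sup>2 = (\<Sum>l<d. (z l)\<^sup>2)"
    unfolding Z_def y_def L2_set_orthonormal[OF V] by (simp add: L2_set_def sum_nonneg)
  have Zpos: "0 < Z"
  proof -
    from z0(1) obtain l where "l \<in> I" "z0 l \<noteq> 0" by auto
    then have "0 < (\<Sum>l<d. (z l)\<^sup>2)" using I by (intro sum_pos2[of _ l]) (auto simp: z_def)
    then have "Z \<noteq> 0" using Z2 by auto
    then show ?thesis by (simp add: Z_def order.strict_iff_order)
  qed
  have "(\<Sum>i<d. \<Sum>j<d. u i * A $$ (i, j) * y j) =
      (\<Sum>l<d. s l * (\<Sum>i<d. U $$ (i, l) * u i) * (\<Sum>j<d. V $$ (j, l) * y j))"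
    by (rule svd_entries_bilinear[OF A])
  also have "\<dots> = (\<Sum>l<d. s l * (s l * z l) * z l)"
    unfolding u_def y_def by (simp add: orthonormal_coefficients[OF U] orthonormal_coefficients[OF V])
  also have "\<dots> = P\<^sup>2" unfolding P2 by (simp add: power2_eq_square mult_ac)
  finally have Aform: "(\<Sum>i<d. \<Sum>j<d. u i * A $$ (i, j) * y j) = P\<^sup>2" .
  have "(\<Sum>i<d. \<Sum>j<d. u i * R $$ (i, j) * y j) =
      (\<Sum>i<d. \<Sum>j<d. u i * A $$ (i, j) * y j) - (\<Sum>i<d. u i * (\<Sum>j<d. \<Theta> $$ (i, j) * y j))"
    by (simp add: R sum_subtractf[symmetric] sum_distrib_left algebra_simps)
  then have "(\<Sum>i<d. \<Sum>j<d. u i * R $$ (i, j) * y j) = P\<^sup>2" using \<Theta>y Aform by simp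
  moreover have "\<bar>\<Sum>i<d. \<Sum>j<d. u i * R $$ (i, j) * y j\<bar> \<le> \<sigma> * P * Z"
    using b unfolding spectral_bound_def P_def Z_def by blast
  ultimately have up: "P * P \<le> P * (\<sigma> * Z)" by (simp add: power2_eq_square mult_ac)
  have "(T * Z)\<^sup>2 = (\<Sum>l<d. (T * z l)\<^sup>2)"
    by (simp add: power_mult_distrib Z2 sum_distrib_left)
  also have "\<dots> \<le> P\<^sup>2" unfolding P2
  proof (rule sum_mono)
    fix l
    have "\<bar>T * z l\<bar> \<le> \<bar>s l * z l\<bar>"
      using T(2) by (auto simp: z_def I_def abs_mult intro!: mult_right_mono)
    then show "(T * z l)\<^sup>2 \<le> (s l * z l)\<^sup>2" by (simp add: abs_le_square_iff)
  qed
  finally have low: "T * Z \<le> P"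
    by (rule power2_le_imp_le) (simp add: P_def)
  then have "0 < P" using T(2) Zpos by (meson mult_pos_pos order_less_le_trans)
  then have "P \<le> \<sigma> * Z" using up by simp
  moreover have "\<sigma> * Z < T * Z" using T(1) Zpos by simp
  ultimately show False using low by simp
qed

lemma factors_through_of_sum:
  assumes I: "finite I" "card I \<le> k"
    and M: "\<And>i j. i < d \<Longrightarrow> j < d \<Longrightarrow> M $$ (i, j) = (\<Sum>l\<in>I. a l i * b l j)"
  shows "factors_through d k M"
proof -
  obtain h where h: "bij_betw h {..<card I} I"
    using ex_bij_betw_nat_finite[OF I(1)] by (auto simp: atLeast0LessThan)
  have "(\<Sum>l\<in>I. a l i * b l j) = (\<Sum>l<card I. a (h l) i * b (h l) j)" for i j
    by (rule sum.reindex_bij_betw[OF h, symmetric])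
  then have "\<forall>i<d. \<forall>j<d. M $$ (i, j) = (\<Sum>l<card I. a (h l) i * b (h l) j)" using M by simp
  then have "factors_through d (card I) M" unfolding factors_through_def
    by (intro exI[of _ "\<lambda>l. a (h l)"] exI[of _ "\<lambda>l. b (h l)"])
  then show ?thesis using I(2) by (rule factors_through_mono)
qed

text \<open>
  If \<open>A\<close> approximates \<open>\<Theta>\<close> to less than the threshold, the singular values that belong to no
  direction of \<open>\<Theta>\<close> are below the threshold and disappear, so the rank of \<open>\<Theta>\<close> is not exceeded.
  Thresholding moves \<open>A\<close> by at most \<open>T\<close> in operator norm, so the new error is at most
  \<open>T + \<sigma> \<le> 2 T\<close>.
\<close>

lemma hard_threshold_step:
  assumes U: "orthonormal_mat d U" and V: "orthonormal_mat d V" and A: "A \<in> carrier_mat d d"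
    and diag: "diagonal_mat (transpose_mat U * A * V)"
    and E: "E = U * hard_threshold T (transpose_mat U * A * V) * transpose_mat V"
    and \<Theta>: "\<Theta> \<in> carrier_mat d d" "factors_through d k \<Theta>"
    and b: "spectral_bound d \<sigma> (A - \<Theta>)" and T: "\<sigma> < T" "0 < T"
  shows "E \<in> carrier_mat d d" and "factors_through d k E" and "spectral_bound d (2 * T) (\<Theta> - E)"
proof -
  from U V have c: "U \<in> carrier_mat d d" "V \<in> carrier_mat d d" by (auto simp: orthonormal_mat_def)
  define D where "D = transpose_mat U * A * V"
  define D' where "D' = hard_threshold T D"
  have D: "D \<in> carrier_mat d d" using c A by (auto simp: D_def)
  have D': "D' \<in> carrier_mat d d" using D by (simp add: D'_def hard_threshold_def)
  have diagD: "diagonal_mat D" using diag by (simp add: D_def)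
  have diagD': "diagonal_mat D'"
    using diagD D by (auto simp: D'_def hard_threshold_def diagonal_mat_def)
  define s where "s = (\<lambda>l. D $$ (l, l))"
  define g where "g l = (if T \<le> \<bar>s l\<bar> then s l else 0)" for l
  have D'l: "D' $$ (l, l) = g l" if "l < d" for l
    using that D by (simp add: D'_def hard_threshold_def g_def s_def)
  have "svd_entries d U s V (U * D * transpose_mat V)"
    unfolding s_def by (rule svd_entries_diagonal[OF c D diagD])
  then have As: "svd_entries d U s V A"
    unfolding D_def orthonormal_conjugation_inverse[OF U V A] .
  have Es: "svd_entries d U g V E"
    using svd_entries_diagonal[OF c D' diagD']
    by (simp add: svd_entries_def D'l E D_def[symmetric] D'_def[symmetric])
  show Ec: "E \<in> carrier_mat d d"
    using c D' by (auto simp: E D_def[symmetric] D'_def[symmetric])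
  define I where "I = {l. l < d \<and> T \<le> \<bar>s l\<bar>}"
  have "card I \<le> k" unfolding I_def
    by (rule card_large_singular_values_le[OF U V As \<Theta>(2) b _ T]) (use A \<Theta> in auto)
  moreover have "finite I" by (auto simp: I_def)
  moreover have "E $$ (i, j) = (\<Sum>l\<in>I. (g l * U $$ (i, l)) * V $$ (j, l))" if "i < d" "j < d" for i j
  proof -
    have "E $$ (i, j) = (\<Sum>l<d. g l * (U $$ (i, l) * V $$ (j, l)))"
      using Es that by (simp add: svd_entries_def)
    also have "\<dots> = (\<Sum>l\<in>I. (g l * U $$ (i, l)) * V $$ (j, l))"
      by (intro sum.mono_neutral_cong_right) (auto simp: I_def g_def)
    finally show ?thesis .
  qed
  ultimately show "factors_through d k E"
    by (intro factors_through_of_sum[where I = I and a = "\<lambda>l i. g l * U $$ (i, l)" and b = "\<lambda>l j. V $$ (j, l)"])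
  have "svd_entries d U (\<lambda>l. s l - g l) V (A - E)"
    using As Es A Ec by (simp add: svd_entries_def sum_subtractf[symmetric] algebra_simps)
  then have "spectral_bound d T (A - E)"
    by (rule spectral_bound_svd_entries[OF U V]) (use T in \<open>auto simp: g_def\<close>)
  then have "spectral_bound d (T + \<sigma>) (\<Theta> - E)"
    by (rule spectral_bound_diff[OF _ b]) (use A \<Theta> Ec in auto)
  then show "spectral_bound d (2 * T) (\<Theta> - E)"
    by (rule spectral_bound_mono) (use T in simp)
qed

section \<open>One iteration of the procedure\<close>

lemma sampling_entries:
  assumes "X i \<in> carrier_mat d d" and "A \<in> carrier_mat d d"
  shows "sampling X A i = (\<Sum>a<d. \<Sum>b<d. X i $$ (a, b) * A $$ (a, b))"
proof -
  have "sampling X A i = (\<Sum>b<d. \<Sum>a<d. X i $$ (a, b) * A $$ (a, b))"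
    using assms by (simp add: sampling_def tr_def scalar_prod_def atLeast0LessThan)
  also have "\<dots> = (\<Sum>a<d. \<Sum>b<d. X i $$ (a, b) * A $$ (a, b))" by (rule sum.swap)
  finally show ?thesis .
qed

lemma sampling_linear_combination:
  assumes "X i \<in> carrier_mat d d" "Z \<in> carrier_mat d d" "W \<in> carrier_mat d d" "H \<in> carrier_mat d d"
    and Z: "\<And>a b. a < d \<Longrightarrow> b < d \<Longrightarrow> Z $$ (a, b) = \<alpha> * W $$ (a, b) + \<beta> * H $$ (a, b)"
  shows "sampling X Z i = \<alpha> * sampling X W i + \<beta> * sampling X H i"
proof -
  have "sampling X Z i = (\<Sum>a<d. \<Sum>b<d. \<alpha> * (X i $$ (a, b) * W $$ (a, b)) + \<beta> * (X i $$ (a, b) * H $$ (a, b)))"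
    unfolding sampling_entries[of X i d Z, OF assms(1,2)]
    by (intro sum.cong refl) (simp add: Z algebra_simps)
  also have "\<dots> = \<alpha> * sampling X W i + \<beta> * sampling X H i"
    unfolding sampling_entries[of X i d W, OF assms(1,3)] sampling_entries[of X i d H, OF assms(1,4)]
    by (simp only: sum.distrib sum_distrib_left)
  finally show ?thesis .
qed

text \<open>
  Polarization for the quadratic form \<open>Q(Z) = |X(Z)|\<^sup>2/n - |Z|\<^sup>2\<close> on the plane spanned by two
  matrices: \<open>P\<close>, \<open>x\<close>, \<open>R\<close> are the coefficients of \<open>Q\<close>, and \<open>a\<close>, \<open>b\<close>, \<open>Y\<close> are the norms and the inner
  product. Comparing \<open>\<beta>\<close> with \<open>-\<beta>\<close> cancels \<open>P\<close>, \<open>R\<close> and \<open>Y\<close>, and \<open>\<alpha> = b\<close>, \<open>\<beta> = a\<close> balances the two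
  remaining terms.
\<close>

lemma quadratic_polarization:
  fixes P x R Y a b c :: real
  assumes *: "\<And>\<alpha> \<beta>. \<bar>\<alpha>\<^sup>2 * P + 2 * \<alpha> * \<beta> * x + \<beta>\<^sup>2 * R\<bar>
      \<le> c * (\<alpha>\<^sup>2 * a\<^sup>2 + 2 * \<alpha> * \<beta> * Y + \<beta>\<^sup>2 * b\<^sup>2)"
    and nn: "0 \<le> a" "0 \<le> b" "0 \<le> c"
  shows "\<bar>x\<bar> \<le> c * a * b"
proof -
  have main: "2 * \<alpha> * \<beta> * \<bar>x\<bar> \<le> c * (\<alpha>\<^sup>2 * a\<^sup>2 + \<beta>\<^sup>2 * b\<^sup>2)" if "0 \<le> \<alpha>" "0 \<le> \<beta>" for \<alpha> \<beta>
  proof -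
    define M where "M = 2 * \<alpha> * \<beta> * x"
    define N where "N = c * (\<alpha>\<^sup>2 * a\<^sup>2 + \<beta>\<^sup>2 * b\<^sup>2)"
    have "\<bar>(\<alpha>\<^sup>2 * P + \<beta>\<^sup>2 * R) + M\<bar> \<le> N + c * (2 * \<alpha> * \<beta> * Y)"
      using *[of \<alpha> \<beta>] by (simp add: M_def N_def algebra_simps)
    moreover have "\<bar>(\<alpha>\<^sup>2 * P + \<beta>\<^sup>2 * R) - M\<bar> \<le> N - c * (2 * \<alpha> * \<beta> * Y)"
      using *[of \<alpha> "- \<beta>"] by (simp add: M_def N_def algebra_simps)
    ultimately have "\<bar>M\<bar> \<le> N" by linarith
    then show ?thesis using that by (simp add: M_def N_def abs_mult)
  qed
  \<comment> \<open>if one norm is zero, the other coefficient can be chosen arbitrarily large\<close>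
  have degenerate: "x = 0" if "\<And>s. 0 \<le> s \<Longrightarrow> 2 * s * \<bar>x\<bar> \<le> e" for e
  proof (rule ccontr)
    assume "x \<noteq> 0"
    have "0 \<le> e" using that[of 0] by simp
    then have "2 * ((e + 1) / \<bar>x\<bar>) * \<bar>x\<bar> \<le> e" by (intro that) simp
    then show False using \<open>x \<noteq> 0\<close> \<open>0 \<le> e\<close> by simp
  qed
  show ?thesis
  proof (cases "a = 0 \<or> b = 0")
    case True
    then show ?thesis
    proof
      assume "a = 0"
      then have "x = 0" using main[of _ 1] by (intro degenerate[of "c * b\<^sup>2"]) simp
      then show ?thesis using nn by simp
    next
      assume "b = 0"
      then have "x = 0" using main[of 1] by (intro degenerate[of "c * a\<^sup>2"]) simp
      then show ?thesis using nn by simp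
    qed
  next
    case False
    then have ab: "0 < 2 * b * a" using nn by simp
    have "2 * b * a * \<bar>x\<bar> \<le> c * (b\<^sup>2 * a\<^sup>2 + a\<^sup>2 * b\<^sup>2)" using main nn by blast
    also have "\<dots> = 2 * b * a * (c * a * b)" by (simp add: power2_eq_square)
    finally show ?thesis using ab by (meson mult_le_cancel_left_pos)
  qed
qed

text \<open>
  Near-isometry also preserves inner products, as long as all combinations of the two matrices stay
  within the rank for which the isometry holds.
\<close>

lemma isometry_bilinear:
  assumes X: "\<And>i. i < n \<Longrightarrow> X i \<in> carrier_mat d d"
    and rip: "\<And>Z. Z \<in> low_rank d m \<Longrightarrow>
      \<bar>(\<Sum>i<n. (sampling X Z i)\<^sup>2) / n - (frob_norm Z)\<^sup>2\<bar> \<le> c * (frob_norm Z)\<^sup>2"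
    and W: "W \<in> carrier_mat d d" "factors_through d a W" and H: "H \<in> carrier_mat d d" "factors_through d b H"
    and m: "a + b \<le> m" and c: "0 \<le> c"
  shows "\<bar>(\<Sum>i<n. sampling X W i * sampling X H i) / n - (\<Sum>i<d. \<Sum>j<d. W $$ (i, j) * H $$ (i, j))\<bar>
    \<le> c * frob_norm W * frob_norm H"
proof -
  define I where "I = (\<Sum>i<d. \<Sum>j<d. W $$ (i, j) * H $$ (i, j))"
  define S where "S = (\<Sum>i<n. sampling X W i * sampling X H i) / n"
  define SW where "SW = (\<Sum>i<n. (sampling X W i)\<^sup>2) / n"
  define SH where "SH = (\<Sum>i<n. (sampling X H i)\<^sup>2) / n"
  have "\<bar>\<alpha>\<^sup>2 * (SW - (frob_norm W)\<^sup>2) + 2 * \<alpha> * \<beta> * (S - I) + \<beta>\<^sup>2 * (SH - (frob_norm H)\<^sup>2)\<bar>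
      \<le> c * (\<alpha>\<^sup>2 * (frob_norm W)\<^sup>2 + 2 * \<alpha> * \<beta> * I + \<beta>\<^sup>2 * (frob_norm H)\<^sup>2)" for \<alpha> \<beta>
  proof -
    define Z where "Z = mat d d (\<lambda>(i, j). \<alpha> * W $$ (i, j) + \<beta> * H $$ (i, j))"
    have Z: "Z \<in> carrier_mat d d" by (simp add: Z_def)
    have Zij: "Z $$ (i, j) = \<alpha> * W $$ (i, j) + \<beta> * H $$ (i, j)" if "i < d" "j < d" for i j
      using that by (simp add: Z_def)
    have "factors_through d m Z"
      using factors_through_linear_combination[OF W(2) H(2) Zij] m by (rule factors_through_mono)
    then have "Z \<in> low_rank d m" using Z mat_rank_le_if_factors_through by (auto simp: low_rank_def)
    note ripZ = rip[OF this]
    have sZ: "sampling X Z i = \<alpha> * sampling X W i + \<beta> * sampling X H i" if "i < n" for i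
      by (rule sampling_linear_combination[where d = d]) (use X[OF that] Z W(1) H(1) Zij in auto)
    have "(\<Sum>i<n. (sampling X Z i)\<^sup>2) = (\<Sum>i<n. \<alpha>\<^sup>2 * (sampling X W i)\<^sup>2
        + 2 * \<alpha> * \<beta> * (sampling X W i * sampling X H i) + \<beta>\<^sup>2 * (sampling X H i)\<^sup>2)"
      by (intro sum.cong refl) (simp add: sZ power2_eq_square algebra_simps)
    also have "\<dots> = \<alpha>\<^sup>2 * (\<Sum>i<n. (sampling X W i)\<^sup>2)
        + 2 * \<alpha> * \<beta> * (\<Sum>i<n. sampling X W i * sampling X H i) + \<beta>\<^sup>2 * (\<Sum>i<n. (sampling X H i)\<^sup>2)"
      by (simp only: sum.distrib sum_distrib_left)
    finally have "(\<Sum>i<n. (sampling X Z i)\<^sup>2) / n = \<alpha>\<^sup>2 * SW + 2 * \<alpha> * \<beta> * S + \<beta>\<^sup>2 * SH"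
      by (simp add: SW_def SH_def S_def add_divide_distrib)
    moreover have "(frob_norm Z)\<^sup>2 = \<alpha>\<^sup>2 * (frob_norm W)\<^sup>2 + 2 * \<alpha> * \<beta> * I + \<beta>\<^sup>2 * (frob_norm H)\<^sup>2"
    proof -
      have "(frob_norm Z)\<^sup>2 = (\<Sum>i<d. \<Sum>j<d. \<alpha>\<^sup>2 * (W $$ (i, j))\<^sup>2
          + 2 * \<alpha> * \<beta> * (W $$ (i, j) * H $$ (i, j)) + \<beta>\<^sup>2 * (H $$ (i, j))\<^sup>2)"
        unfolding frob_norm_square[OF Z]
        by (intro sum.cong refl) (simp add: Zij power2_eq_square algebra_simps)
      also have "\<dots> = \<alpha>\<^sup>2 * (frob_norm W)\<^sup>2 + 2 * \<alpha> * \<beta> * I + \<beta>\<^sup>2 * (frob_norm H)\<^sup>2"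
        unfolding frob_norm_square[OF W(1)] frob_norm_square[OF H(1)] I_def
        by (simp only: sum.distrib sum_distrib_left)
      finally show ?thesis .
    qed
    ultimately show ?thesis using ripZ by (simp add: algebra_simps)
  qed
  then show ?thesis unfolding I_def[symmetric] S_def[symmetric]
    by (rule quadratic_polarization) (simp_all add: frob_norm_nonneg c)
qed

text \<open>
  Tested against \<open>W = u v\<^sup>T\<close>, the matrix before thresholding deviates from \<open>\<Theta>\<close> by the isometry defect
  between \<open>W\<close> and \<open>D = \<Theta> - E\<close> plus the noise paired with \<open>W\<close>. Since \<open>W\<close> has rank at most one and
  Frobenius norm \<open>|u| |v|\<close>, both are controlled by \<open>|u| |v|\<close>.
\<close>

lemma gradient_step_error:
  assumes X: "\<And>i. i < n \<Longrightarrow> X i \<in> carrier_mat d d"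
    and rip: "\<And>Z. Z \<in> low_rank d m \<Longrightarrow>
      \<bar>(\<Sum>i<n. (sampling X Z i)\<^sup>2) / n - (frob_norm Z)\<^sup>2\<bar> \<le> c * (frob_norm Z)\<^sup>2"
    and noise: "noise_bound C d n X \<delta> \<epsilon>"
    and \<Theta>: "\<Theta> \<in> carrier_mat d d" and E: "E \<in> carrier_mat d d"
    and H: "factors_through d b (\<Theta> - E)" and m: "1 + b \<le> m" and c: "0 \<le> c"
  shows "spectral_bound d (c * frob_norm (\<Theta> - E) + C * rate d n \<delta>)
    (E + residual_mat d n X (\<lambda>i. sampling X \<Theta> i + \<epsilon> i) E - \<Theta>)"
  unfolding spectral_bound_def
proof (intro allI)
  fix u v :: "nat \<Rightarrow> real"
  let ?R = "E + residual_mat d n X (\<lambda>i. sampling X \<Theta> i + \<epsilon> i) E - \<Theta>"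
  define W where "W = mat d d (\<lambda>(i, j). u i * v j)"
  define D where "D = \<Theta> - E"
  have W: "W \<in> carrier_mat d d" by (simp add: W_def)
  have Wij: "W $$ (i, j) = u i * v j" if "i < d" "j < d" for i j using that by (simp add: W_def)
  have D: "D \<in> carrier_mat d d" unfolding D_def using E by (rule minus_carrier_mat)
  have fW: "factors_through d 1 W"
    unfolding factors_through_def by (intro exI[of _ "\<lambda>_. u"] exI[of _ "\<lambda>_. v"]) (simp add: Wij)
  have normW: "frob_norm W = L2_set u {..<d} * L2_set v {..<d}"
    using W unfolding L2_set_tensor[symmetric] by (simp add: frob_norm_def Wij)
  have sD: "sampling X \<Theta> i + \<epsilon> i - sampling X E i = sampling X D i + \<epsilon> i" if "i < n" for i
    using sampling_linear_combination[where d = d and Z = D and W = \<Theta> and H = E and X = X and i = i and \<alpha> = 1 and \<beta> = "- 1",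
        OF X[OF that] D \<Theta> E] \<Theta> E by (simp add: D_def)
  have Rij: "?R $$ (a, b) = (\<Sum>i<n. X i $$ (a, b) * (sampling X D i + \<epsilon> i)) / n - D $$ (a, b)"
    if "a < d" "b < d" for a b
    using that \<Theta> E by (simp add: residual_mat_def D_def sD)
  have "u a * ?R $$ (a, b) * v b =
      (\<Sum>i<n. X i $$ (a, b) * W $$ (a, b) * (sampling X D i + \<epsilon> i)) / n - W $$ (a, b) * D $$ (a, b)"
    if "a < d" "b < d" for a b
  proof -
    have "(\<Sum>i<n. X i $$ (a, b) * W $$ (a, b) * (sampling X D i + \<epsilon> i)) =
        W $$ (a, b) * (\<Sum>i<n. X i $$ (a, b) * (sampling X D i + \<epsilon> i))"
      unfolding sum_distrib_left by (simp only: mult_ac)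
    then show ?thesis unfolding Rij[OF that] by (simp add: Wij[OF that] algebra_simps)
  qed
  then have "(\<Sum>a<d. \<Sum>b<d. u a * ?R $$ (a, b) * v b) =
      (\<Sum>a<d. \<Sum>b<d. (\<Sum>i<n. X i $$ (a, b) * W $$ (a, b) * (sampling X D i + \<epsilon> i)) / n
        - W $$ (a, b) * D $$ (a, b))" by (intro sum.cong refl) auto
  also have "\<dots> =
      (\<Sum>a<d. \<Sum>b<d. \<Sum>i<n. X i $$ (a, b) * W $$ (a, b) * (sampling X D i + \<epsilon> i)) / n
      - (\<Sum>a<d. \<Sum>b<d. W $$ (a, b) * D $$ (a, b))"
    by (simp only: sum_subtractf sum_divide_distrib)
  also have "(\<Sum>a<d. \<Sum>b<d. \<Sum>i<n. X i $$ (a, b) * W $$ (a, b) * (sampling X D i + \<epsilon> i)) =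
      (\<Sum>a<d. \<Sum>i<n. \<Sum>b<d. X i $$ (a, b) * W $$ (a, b) * (sampling X D i + \<epsilon> i))"
    by (rule sum.cong[OF refl], rule sum.swap)
  also have "\<dots> = (\<Sum>i<n. \<Sum>a<d. \<Sum>b<d. X i $$ (a, b) * W $$ (a, b) * (sampling X D i + \<epsilon> i))"
    by (rule sum.swap)
  also have "\<dots> = (\<Sum>i<n. sampling X W i * (sampling X D i + \<epsilon> i))"
    by (intro sum.cong refl) (simp add: sampling_entries[OF X W] sum_distrib_right)
  also have "\<dots> = (\<Sum>i<n. sampling X W i * sampling X D i) + (\<Sum>i<n. sampling X W i * \<epsilon> i)"
    by (simp only: distrib_left sum.distrib)
  finally have eq: "(\<Sum>a<d. \<Sum>b<d. u a * ?R $$ (a, b) * v b) =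
      ((\<Sum>i<n. sampling X W i * sampling X D i) / n - (\<Sum>a<d. \<Sum>b<d. W $$ (a, b) * D $$ (a, b)))
      + (\<Sum>i<n. sampling X W i * \<epsilon> i) / n"
    by (simp add: add_divide_distrib)
  have "\<bar>(\<Sum>i<n. sampling X W i * sampling X D i) / n - (\<Sum>a<d. \<Sum>b<d. W $$ (a, b) * D $$ (a, b))\<bar>
      \<le> c * frob_norm W * frob_norm D"
    by (rule isometry_bilinear[OF X rip W fW D _ m c]) (use H in \<open>simp_all add: D_def\<close>)
  moreover have "\<bar>(\<Sum>i<n. sampling X W i * \<epsilon> i) / n\<bar> \<le> C * frob_norm W * rate d n \<delta>"
    using noise W mat_rank_le_if_factors_through[OF W fW] by (simp add: noise_bound_def low_rank_def)
  ultimately have "\<bar>\<Sum>a<d. \<Sum>b<d. u a * ?R $$ (a, b) * v b\<bar>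
      \<le> c * frob_norm W * frob_norm D + C * frob_norm W * rate d n \<delta>"
    unfolding eq by linarith
  also have "\<dots> = (c * frob_norm (\<Theta> - E) + C * rate d n \<delta>) * L2_set u {..<d} * L2_set v {..<d}"
    by (simp add: normW D_def algebra_simps)
  finally show "\<bar>\<Sum>i<d. \<Sum>j<d. u i * ?R $$ (i, j) * v j\<bar>
      \<le> (c * frob_norm (\<Theta> - E) + C * rate d n \<delta>) * L2_set u {..<d} * L2_set v {..<d}" .
qed

section \<open>Convergence of the iteration\<close>

lemma rate_nonneg: "0 < \<delta> \<Longrightarrow> \<delta> < 1 \<Longrightarrow> 0 \<le> rate d n \<delta>"
  by (simp add: rate_def)

lemma threshold_pos:
  assumes "0 < B" "0 < \<rho>" "0 \<le> \<upsilon>"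
  shows "0 < threshold B \<rho> \<upsilon> r"
  using assms by (induction r) (auto intro: add_pos_nonneg)

text \<open>
  The number \<open>\<upsilon> / (1 - \<kappa>)\<close> is the fixed point of \<open>T \<mapsto> \<kappa> T + \<upsilon>\<close>, a contraction that dominates the
  threshold recursion because \<open>\<rho> \<le> \<kappa>\<close>.
\<close>

lemma threshold_le:
  assumes "0 < B" "0 < \<rho>" "\<rho> \<le> \<kappa>" "\<kappa> < 1" "0 \<le> \<upsilon>"
  shows "threshold B \<rho> \<upsilon> r \<le> \<kappa> ^ r * B + \<upsilon> / (1 - \<kappa>)"
proof (induction r)
  case 0
  then show ?case using assms by simp
next
  case (Suc r)
  have "\<rho> * threshold B \<rho> \<upsilon> r \<le> \<kappa> * threshold B \<rho> \<upsilon> r"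
    using assms threshold_pos[of B \<rho> \<upsilon> r] by (intro mult_right_mono) auto
  also have "\<dots> \<le> \<kappa> * (\<kappa> ^ r * B + \<upsilon> / (1 - \<kappa>))"
    using assms Suc.IH by (intro mult_left_mono) auto
  finally have "threshold B \<rho> \<upsilon> (Suc r) \<le> \<kappa> * (\<kappa> ^ r * B + \<upsilon> / (1 - \<kappa>)) + \<upsilon>" by simp
  also have "\<dots> = \<kappa> ^ Suc r * B + \<upsilon> / (1 - \<kappa>)" using assms by (simp add: field_simps)
  finally show ?case .
qed

text \<open>
  The induction that drives the convergence: the estimate never has larger rank than \<open>\<Theta>\<close>, and its
  operator norm error is at most twice the current threshold. The error matrix then has rank at most
  \<open>2 k \<le> K\<close>, hence Frobenius norm at most \<open>2 sqrt(K) T\<close>, and the next gradient step is accurate up to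
  \<open>2 c sqrt(K) T + \<upsilon>\<close>. The factor \<open>4\<close> in the contraction rate puts the next threshold strictly above
  this number.
\<close>

lemma iht_invariant:
  assumes X: "\<And>i. i < n \<Longrightarrow> X i \<in> carrier_mat d d"
    and iso: "isometry_condition d n X K c" and K: "0 < K"
    and noise: "noise_bound C d n X \<delta> \<epsilon>" and \<upsilon>: "0 \<le> C * rate d n \<delta>" and B: "0 < B"
    and k: "2 * k \<le> K" and \<Theta>: "\<Theta> \<in> low_rank d k" "frob_norm \<Theta> \<le> B"
    and E: "iht_estimates d n X (\<lambda>i. sampling X \<Theta> i + \<epsilon> i)
      (threshold B (4 * c (2 * K) * sqrt (real K)) (C * rate d n \<delta>)) E"
  shows "E r \<in> carrier_mat d d \<and> factors_through d k (E r) \<and>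
    spectral_bound d (2 * threshold B (4 * c (2 * K) * sqrt (real K)) (C * rate d n \<delta>) r) (\<Theta> - E r)"
proof -
  let ?T = "threshold B (4 * c (2 * K) * sqrt (real K)) (C * rate d n \<delta>)"
  have \<Theta>c: "\<Theta> \<in> carrier_mat d d" and f\<Theta>: "factors_through d k \<Theta>"
    using \<Theta>(1) factors_through_if_mat_rank_le by (auto simp: low_rank_def)
  have c: "0 < c (2 * K)" using iso by (simp add: isometry_condition_def)
  show ?thesis
  proof (induction r)
    case 0
    have E0: "E 0 = 0\<^sub>m d d" using E by (simp add: iht_estimates_def)
    have "factors_through d k (E 0)"
      unfolding factors_through_def by (intro exI[of _ "\<lambda>_ _. 0"]) (simp add: E0)
    moreover have "spectral_bound d (2 * ?T 0) \<Theta>"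
      by (rule spectral_bound_mono[OF spectral_bound_frob_norm[OF \<Theta>c]]) (use \<Theta>(2) B in simp)
    moreover have "\<Theta> - E 0 = \<Theta>" using \<Theta>c by (intro eq_matI) (auto simp: E0)
    ultimately show ?case by (simp add: E0)
  next
    case (Suc r)
    let ?A = "E r + residual_mat d n X (\<lambda>i. sampling X \<Theta> i + \<epsilon> i) (E r)"
    have T: "0 < ?T r'" for r' using B c K \<upsilon> by (intro threshold_pos) auto
    from Suc have Ec: "E r \<in> carrier_mat d d" and fE: "factors_through d k (E r)"
      and bE: "spectral_bound d (2 * ?T r) (\<Theta> - E r)" by auto
    have fD: "factors_through d (k + k) (\<Theta> - E r)"
      by (rule factors_through_linear_combination[OF f\<Theta> fE, of _ 1 "- 1"]) (use \<Theta>c Ec in auto)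
    have "frob_norm (\<Theta> - E r) \<le> sqrt (k + k) * (2 * ?T r)"
      by (rule frob_norm_le_of_factors_through[OF _ fD bE]) (use \<Theta>c Ec T[of r] in auto)
    also have "\<dots> \<le> sqrt K * (2 * ?T r)"
      using k T[of r] by (intro mult_right_mono) auto
    finally have fr: "frob_norm (\<Theta> - E r) \<le> sqrt K * (2 * ?T r)" .
    have "spectral_bound d (c (2 * K) * frob_norm (\<Theta> - E r) + C * rate d n \<delta>) (?A - \<Theta>)"
    proof (rule gradient_step_error[OF X _ noise \<Theta>c Ec fD])
      \<comment> \<open>the error matrix together with one rank-one test matrix\<close>
      show "1 + (k + k) \<le> 2 * K" using k K by simp
      show "\<bar>(\<Sum>i<n. (sampling X Z i)\<^sup>2) / n - (frob_norm Z)\<^sup>2\<bar> \<le> c (2 * K) * (frob_norm Z)\<^sup>2"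
        if "Z \<in> low_rank d (2 * K)" for Z using iso that by (simp add: isometry_condition_def)
    qed (use c in auto)
    moreover have "c (2 * K) * frob_norm (\<Theta> - E r) + C * rate d n \<delta> < ?T (Suc r)"
    proof -
      define t where "t = c (2 * K) * sqrt K * ?T r"
      have "c (2 * K) * frob_norm (\<Theta> - E r) \<le> c (2 * K) * (sqrt K * (2 * ?T r))"
        using c fr by (intro mult_left_mono) auto
      then have "c (2 * K) * frob_norm (\<Theta> - E r) \<le> 2 * t" by (simp add: t_def mult_ac)
      moreover have "0 < t" using c K T[of r] by (simp add: t_def)
      moreover have "?T (Suc r) = 4 * t + C * rate d n \<delta>" by (simp add: t_def)
      ultimately show ?thesis by linarith
    qed
    moreover from E obtain U V where "orthonormal_mat d U" "orthonormal_mat d V"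
      "diagonal_mat (transpose_mat U * ?A * V)"
      "E (Suc r) = U * hard_threshold (?T (Suc r)) (transpose_mat U * ?A * V) * transpose_mat V"
      unfolding iht_estimates_def Let_def by blast
    moreover have "?A \<in> carrier_mat d d" using Ec by (simp add: residual_mat_def)
    ultimately show ?case
      using hard_threshold_step[of d U V ?A "E (Suc r)" "?T (Suc r)" \<Theta> k] \<Theta>c f\<Theta> T[of "Suc r"] by blast
  qed
qed

text \<open>
  A number of iterations proportional to \<open>ln n\<close> makes \<open>\<kappa> ^ r\<close> a negative power of \<open>n\<close>. One part of \<open>L\<close>
  produces the exponent \<open>-1/2\<close>; the other part absorbs the constant \<open>B / g\<close>, for which \<open>ln n \<ge> ln 2\<close>
  is used.
\<close>

lemma geometric_decay_below_inverse_sqrt: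
  fixes \<kappa> B g :: real
  assumes "\<kappa> < 1" "0 < B" "0 < g"
  shows "\<exists>L>0. \<forall>(n :: nat) (r :: nat). 2 \<le> n \<longrightarrow> 0 < \<kappa> \<longrightarrow> L * ln n \<le> r \<longrightarrow> \<kappa> ^ r * B \<le> g / sqrt n"
proof (cases "0 < \<kappa>")
  case False
  then show ?thesis by (intro exI[of _ 1]) auto
next
  case True
  define a where "a = - ln \<kappa>"
  have a: "0 < a" using True assms by (simp add: a_def)
  define e where "e = \<bar>ln (B / g)\<bar> / ln 2"
  have e: "0 \<le> e" by (simp add: e_def)
  define L where "L = (1 / 2 + e) / a"
  have L: "0 < L" using a e by (simp add: L_def)
  have "\<kappa> ^ r * B \<le> g / sqrt n" if n: "2 \<le> n" and r: "L * ln n \<le> r" for n r :: nat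
  proof -
    have ln2: "ln 2 \<le> ln (real n)" using n by simp
    have "ln (B / g) \<le> e * ln 2" by (simp add: e_def)
    also have "\<dots> \<le> e * ln n" using e ln2 by (intro mult_left_mono) auto
    finally have "ln (B / g) + ln n / 2 \<le> (1 / 2 + e) * ln n" by (simp add: algebra_simps)
    also have "\<dots> = a * (L * ln n)" using a by (simp add: L_def)
    also have "\<dots> \<le> a * r" using a r by (intro mult_left_mono) auto
    finally have "ln (B / g) + ln n / 2 \<le> a * r" .
    then have "real r * ln \<kappa> + ln B \<le> ln g - ln n / 2"
      using assms by (simp add: a_def ln_div algebra_simps)
    then have "ln (\<kappa> ^ r * B) \<le> ln (g / sqrt n)"
      using True assms n by (simp add: ln_mult ln_div ln_realpow ln_sqrt)
    then show ?thesis using True assms n by (subst (asm) ln_le_cancel_iff) auto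
  qed
  then show ?thesis using L by blast
qed

text \<open>
  For \<open>k = 0\<close> both \<open>\<Theta>\<close> and the estimate have rank zero and coincide, however large the threshold
  still is. This case is kept apart because \<open>r \<ge> L ln n\<close> enforces no iteration for \<open>n = 1\<close>, where
  \<open>2 k \<le> K \<le> d \<le> n\<close> leaves only \<open>k = 0\<close>.
\<close>

lemma iht_error_bounds:
  assumes X: "\<And>i. i < n \<Longrightarrow> X i \<in> carrier_mat d d"
    and iso: "isometry_condition d n X K c" and K: "0 < K"
    and noise: "noise_bound C d n X \<delta> \<epsilon>" and \<upsilon>: "0 \<le> C * rate d n \<delta>" and B: "0 < B"
    and k: "2 * k \<le> K" and \<Theta>: "\<Theta> \<in> low_rank d k" "frob_norm \<Theta> \<le> B"
    and E: "iht_estimates d n X (\<lambda>i. sampling X \<Theta> i + \<epsilon> i)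
      (threshold B (4 * c (2 * K) * sqrt (real K)) (C * rate d n \<delta>)) E"
    and t: "0 \<le> t"
      "0 < k \<Longrightarrow> 2 * threshold B (4 * c (2 * K) * sqrt (real K)) (C * rate d n \<delta>) r \<le> t"
  shows "op_norm (\<Theta> - E r) \<le> t" and "mat_rank d (E r) \<le> k"
    and "0 < p \<Longrightarrow> schatten_norm p (\<Theta> - E r) \<le> 2 powr (1 / p) * real k powr (1 / p) * t"
proof -
  let ?T = "threshold B (4 * c (2 * K) * sqrt (real K)) (C * rate d n \<delta>)"
  have inv: "E r \<in> carrier_mat d d" "factors_through d k (E r)" "spectral_bound d (2 * ?T r) (\<Theta> - E r)"
    using iht_invariant[OF X iso K noise \<upsilon> B k \<Theta> E, of r] by auto
  have \<Theta>c: "\<Theta> \<in> carrier_mat d d" and f\<Theta>: "factors_through d k \<Theta>"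
    using \<Theta>(1) factors_through_if_mat_rank_le by (auto simp: low_rank_def)
  have D: "\<Theta> - E r \<in> carrier_mat d d" using inv(1) by (rule minus_carrier_mat)
  have fD: "factors_through d (2 * k) (\<Theta> - E r)"
    using factors_through_linear_combination[OF f\<Theta> inv(2), of "\<Theta> - E r" 1 "- 1"] \<Theta>c inv(1)
    by (simp add: mult_2)
  have bound: "spectral_bound d t (\<Theta> - E r)"
  proof (cases "k = 0")
    case True
    then have "(\<Theta> - E r) $$ (i, j) = 0" if "i < d" "j < d" for i j
      using fD that by (simp add: factors_through_def)
    then show ?thesis using t(1) by (simp add: spectral_bound_def)
  next
    case False
    then show ?thesis using spectral_bound_mono[OF inv(3) t(2)] by simp
  qed
  show "op_norm (\<Theta> - E r) \<le> t"
    by (rule op_norm_le[OF D _ bound t(1)]) (use iso K in \<open>simp add: isometry_condition_def\<close>)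
  show "mat_rank d (E r) \<le> k" by (rule mat_rank_le_if_factors_through[OF inv(1,2)])
  show "schatten_norm p (\<Theta> - E r) \<le> 2 powr (1 / p) * real k powr (1 / p) * t" if "0 < p"
    using schatten_norm_le[OF D fD bound t(1) that] by (simp add: powr_mult)
qed

text \<open>
  Once the initial radius \<open>B\<close> has decayed below the statistical rate, only the fixed point of the
  threshold recursion is left. The upper bound \<open>\<delta>\<^sub>0 < 1\<close> keeps the rate away from zero.
\<close>

lemma threshold_le_rate:
  assumes d: "0 < d" and \<delta>: "0 < \<delta>" "\<delta> \<le> \<delta>\<^sub>0" "\<delta>\<^sub>0 < 1" and C: "0 < C" and B: "0 < B"
    and \<rho>: "0 < \<rho>" "\<rho> \<le> \<kappa>" "\<kappa> < 1"
    and decay: "\<kappa> ^ r * B \<le> C * sqrt (ln (1 / \<delta>\<^sub>0)) / sqrt n"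
  shows "threshold B \<rho> (C * rate d n \<delta>) r \<le> C * (1 + 1 / (1 - \<kappa>)) * rate d n \<delta>"
proof -
  have "threshold B \<rho> (C * rate d n \<delta>) r \<le> \<kappa> ^ r * B + C * rate d n \<delta> / (1 - \<kappa>)"
    using B \<rho> C rate_nonneg[of \<delta> d n] \<delta> by (intro threshold_le) auto
  moreover have "\<kappa> ^ r * B \<le> C * rate d n \<delta>"
  proof -
    have pos: "0 \<le> ln (1 / \<delta>)" using \<delta> by simp
    have "ln (1 / \<delta>\<^sub>0) \<le> 1 * ln (1 / \<delta>)" using \<delta> by (simp add: ln_div)
    also have "\<dots> \<le> d * ln (1 / \<delta>)" using d pos by (intro mult_right_mono) auto
    finally have "C * sqrt (ln (1 / \<delta>\<^sub>0) / n) \<le> C * rate d n \<delta>" unfolding rate_def using C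
      by (intro mult_left_mono real_sqrt_le_mono divide_right_mono) auto
    then show ?thesis using decay by (simp add: real_sqrt_divide)
  qed
  ultimately have "threshold B \<rho> (C * rate d n \<delta>) r \<le> C * rate d n \<delta> + C * rate d n \<delta> / (1 - \<kappa>)"
    by linarith
  also have "\<dots> = C * (1 + 1 / (1 - \<kappa>)) * rate d n \<delta>" by (simp add: algebra_simps)
  finally show ?thesis .
qed

theorem theorem3p1:
  fixes C q :: real
  assumes "C > 0" and "q < 1 / 4"
  shows "\<exists>C\<^sub>1>0. \<exists>C' :: real \<Rightarrow> real.
    (\<forall>p>0. 0 < C' p \<and> C' p \<le> 2 powr (1 / p) * C\<^sub>1) \<and>
    (\<forall>B>0. \<forall>\<delta>\<^sub>0\<in>{0<..<1}. \<exists>L>0.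
      \<forall>(d :: nat) (n :: nat) (K :: nat) (X :: nat \<Rightarrow> real mat) (c :: nat \<Rightarrow> real) (\<delta> :: real) (r :: nat).
        d \<le> n \<and> (\<forall>i<n. X i \<in> carrier_mat d d) \<and>
        0 < K \<and> isometry_condition d n X K c \<and> c (2 * K) * sqrt (real K) \<le> q \<and>
        0 < \<delta> \<and> \<delta> \<le> \<delta>\<^sub>0 \<and>
        with_prob_gt (1 - \<delta>) (white_noise n) (noise_bound C d n X \<delta>) \<and>
        real r \<ge> L * ln (real n) \<longrightarrow>
        with_prob_gt (1 - \<delta>) (white_noise n) (\<lambda>\<epsilon>.
          \<forall>k :: nat. real k \<le> real K / 2 \<longrightarrow>
            (\<forall>\<Theta>\<in>low_rank d k. frob_norm \<Theta> \<le> B \<longrightarrow>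
              (\<forall>E. iht_estimates d n X (\<lambda>i. sampling X \<Theta> i + \<epsilon> i)
                     (threshold B (4 * c (2 * K) * sqrt (real K)) (C * rate d n \<delta>)) E \<longrightarrow>
                op_norm (\<Theta> - E r) \<le> C\<^sub>1 * rate d n \<delta> \<and>
                mat_rank d (E r) \<le> k \<and>
                (\<forall>p>0. schatten_norm p (\<Theta> - E r) \<le> C' p * real k powr (1 / p) * rate d n \<delta>)))))"
proof -
  \<comment> \<open>twice the sum of the fixed point of the thresholds and one unit of the noise level for the decayed radius \<open>B\<close>\<close>
  define C1 where "C1 = 2 * C * (1 + 1 / (1 - 4 * q))"
  define C' where "C' p = 2 powr (1 / p) * C1" for p :: real
  have C1: "0 < C1" using assms by (simp add: C1_def add_pos_pos)
  define good where "good B d n K X c \<delta> r \<epsilon> \<longleftrightarrow>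
      (\<forall>k :: nat. real k \<le> real K / 2 \<longrightarrow>
        (\<forall>\<Theta>\<in>low_rank d k. frob_norm \<Theta> \<le> B \<longrightarrow>
          (\<forall>E. iht_estimates d n X (\<lambda>i. sampling X \<Theta> i + \<epsilon> i)
                 (threshold B (4 * c (2 * K) * sqrt (real K)) (C * rate d n \<delta>)) E \<longrightarrow>
            op_norm (\<Theta> - E r) \<le> C1 * rate d n \<delta> \<and>
            mat_rank d (E r) \<le> k \<and>
            (\<forall>p>0. schatten_norm p (\<Theta> - E r) \<le> C' p * real k powr (1 / p) * rate d n \<delta>))))"
    for B :: real and d n K :: nat and X :: "nat \<Rightarrow> real mat" and c :: "nat \<Rightarrow> real" and \<delta> :: real
      and r :: nat and \<epsilon> :: "nat \<Rightarrow> real"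
  have "\<exists>L>0. \<forall>d n K X c \<delta> r.
        d \<le> n \<and> (\<forall>i<n. X i \<in> carrier_mat d d) \<and>
        0 < K \<and> isometry_condition d n X K c \<and> c (2 * K) * sqrt (real K) \<le> q \<and>
        0 < \<delta> \<and> \<delta> \<le> \<delta>\<^sub>0 \<and>
        with_prob_gt (1 - \<delta>) (white_noise n) (noise_bound C d n X \<delta>) \<and>
        real r \<ge> L * ln (real n) \<longrightarrow>
        with_prob_gt (1 - \<delta>) (white_noise n) (\<lambda>\<epsilon>. good B d n K X c \<delta> r \<epsilon>)"
    if B: "0 < B" and \<delta>\<^sub>0: "\<delta>\<^sub>0 \<in> {0<..<1}" for B \<delta>\<^sub>0 :: real
  proof -
    have g: "0 < C * sqrt (ln (1 / \<delta>\<^sub>0))" using assms \<delta>\<^sub>0 by (simp add: ln_div)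
    obtain L where L: "0 < L" and decay:
      "\<And>(n :: nat) (r :: nat). 2 \<le> n \<Longrightarrow> 0 < 4 * q \<Longrightarrow> L * ln n \<le> r \<Longrightarrow>
        (4 * q) ^ r * B \<le> C * sqrt (ln (1 / \<delta>\<^sub>0)) / sqrt n"
      using geometric_decay_below_inverse_sqrt[of "4 * q", OF _ B g] assms by auto
    show ?thesis
    proof (intro exI[of _ L] conjI L allI impI, elim conjE)
      fix d n K :: nat and X :: "nat \<Rightarrow> real mat" and c :: "nat \<Rightarrow> real" and \<delta> :: real and r :: nat
      assume dn: "d \<le> n" and X: "\<forall>i<n. X i \<in> carrier_mat d d" and K: "0 < K"
        and iso: "isometry_condition d n X K c" and cq: "c (2 * K) * sqrt (real K) \<le> q"
        and \<delta>: "0 < \<delta>" "\<delta> \<le> \<delta>\<^sub>0"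
        and noise: "with_prob_gt (1 - \<delta>) (white_noise n) (noise_bound C d n X \<delta>)"
        and r: "real r \<ge> L * ln (real n)"
      have rate: "0 \<le> rate d n \<delta>" using \<delta> \<delta>\<^sub>0 by (intro rate_nonneg) auto
      have Kd: "K \<le> d" and c: "0 < c (2 * K)" using iso by (auto simp: isometry_condition_def)
      have \<rho>: "0 < 4 * c (2 * K) * sqrt (real K)" using c K by simp
      have q: "0 < 4 * q" using \<rho> cq by linarith
      have "good B d n K X c \<delta> r \<epsilon>" if \<epsilon>: "noise_bound C d n X \<delta> \<epsilon>" for \<epsilon>
        unfolding good_def
      proof (intro allI impI ballI)
        fix k :: nat and \<Theta> E
        let ?T = "threshold B (4 * c (2 * K) * sqrt (real K)) (C * rate d n \<delta>)"
        assume k: "real k \<le> real K / 2" and \<Theta>: "\<Theta> \<in> low_rank d k" "frob_norm \<Theta> \<le> B"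
          and E: "iht_estimates d n X (\<lambda>i. sampling X \<Theta> i + \<epsilon> i) ?T E"
        have k2: "2 * k \<le> K" using k by linarith
        have T: "2 * ?T r \<le> C1 * rate d n \<delta>" if "0 < k"
        proof -
          \<comment> \<open>\<open>2 \<le> 2 k \<le> K \<le> d \<le> n\<close>\<close>
          have n: "2 \<le> n" using that k2 Kd dn by linarith
          have "?T r \<le> C * (1 + 1 / (1 - 4 * q)) * rate d n \<delta>"
            by (rule threshold_le_rate[OF _ \<delta> _ assms(1) B \<rho> _ _ decay[OF n q r]])
              (use K Kd \<delta>\<^sub>0 cq assms in auto)
          then show ?thesis by (simp add: C1_def)
        qed
        have \<upsilon>: "0 \<le> C * rate d n \<delta>" and t: "0 \<le> C1 * rate d n \<delta>" using assms C1 rate by auto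
        note bounds = iht_error_bounds[OF X[rule_format] iso K \<epsilon> \<upsilon> B k2 \<Theta> E t T]
        show "op_norm (\<Theta> - E r) \<le> C1 * rate d n \<delta> \<and> mat_rank d (E r) \<le> k \<and>
            (\<forall>p>0. schatten_norm p (\<Theta> - E r) \<le> C' p * real k powr (1 / p) * rate d n \<delta>)"
          using bounds by (simp add: C'_def mult_ac)
      qed
      then show "with_prob_gt (1 - \<delta>) (white_noise n) (\<lambda>\<epsilon>. good B d n K X c \<delta> r \<epsilon>)"
        using noise unfolding with_prob_gt_def by blast
    qed
  qed
  moreover have "\<forall>p>0. 0 < C' p \<and> C' p \<le> 2 powr (1 / p) * C1" using C1 by (simp add: C'_def)
  ultimately show ?thesis using C1 unfolding good_def by blast
qed

end
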